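(* Let $n\ge 2$, $s\in(0,1)$, $r>0$, let $\mathbb{B}_r=\{x\in\mathbb{R}^n:|x|<r\}$ and $x_0\in\mathbb{B}_r$. Consider the walk-on-spheres Markov chain $(X_k)_{k\ge0}$ defined by $X_0=x_0$ and, as long as $X_k\in\mathbb{B}_r$, setting $r_k=r-|X_k|$ and drawing $X_{k+1}$ (independently of the past given $X_k$) from the probability density $$x\mapsto \alpha(n,s)\left(\frac{r_k^{2}}{|x-X_k|^{2}-r_k^{2}}\right)^{s}\frac{1}{|x-X_k|^{n}},\qquad |x-X_k|>r_k .$$ Let $l=\min\{k\ge1: X_k\notin\mathbb{B}_r\}$ be the number of steps. Define $s_1=s$ if $s\in(0,\tfrac13]$ and $s_1=\tfrac{1-s}{2}$ if $s\in(\tfrac13,1)$, and set $\gamma=\frac{(1+s_1+s)(s_1-n)}{1-s_1-s}+n$. Then $$ \mathbb{E}(l)\le 2^{4s+1}\pi^{\frac n2}\frac{\Gamma(s+\frac n2)\Gamma(s+1)}{\Gamma^2(\frac n2)}C_4(n,s)\Bigg\{\frac{2^{s}}{s_1}+(r-|x_0|)^{s}\left[r^{\,n-\frac{1+s_1+s}{2}}B\!\left(1-\tfrac{1+s_1+s}{2},\,n\right)\right]^{\frac{2(s_1+s)}{1+s_1+s}}\left(\frac{1}{\gamma}\left[(r+|x_0|)^{\gamma}-\left(\tfrac{r-|x_0|}{2}\right)^{\gamma}\right]\right)^{\frac{1-s_1-s}{1+s_1+s}}\Bigg\}. $$ Moreover, the right-hand side is an increasing function of $s$ and an increasing function of $|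x_0|$.
   Context: $\alpha(n,s)=\dfrac{\Gamma(\frac n2)\sin(\pi s)}{\pi^{\frac n2+1}}$ (so the displayed density is a probability density on $\{|x-X_k|>r_k\}$). $B(\cdot,\cdot)$ is the Beta function. $C_4(n,s)=\pi^{-n/2}\Gamma(s)^{-1}\max\left\{\dfrac{2^{2s}\Gamma(\frac n2)}{\Gamma(1+s)},\ \Gamma\!\left(\tfrac n2-s\right)\right\}$. *)

theory Defs
  imports "HOL-Analysis.Analysis" "HOL-Probability.Probability"
begin

definition alpha_ns :: "nat \<Rightarrow> real \<Rightarrow> real" where
  "alpha_ns n s = Gamma (real n / 2) * sin (pi * s) / pi powr (real n / 2 + 1)"

definition wos_kernel :: "real \<Rightarrow> real \<Rightarrow> real^'n \<Rightarrow> (real^'n) measure" where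
  "wos_kernel s r X = (let rk = r - norm X in
     density lborel (\<lambda>x. ennreal (if dist x X > rk then
        alpha_ns CARD('n) s * (rk\<^sup>2 / ((dist x X)\<^sup>2 - rk\<^sup>2)) powr s / (dist x X) ^ CARD('n)
      else 0)))"

definition wos_step :: "real \<Rightarrow> real \<Rightarrow> real^'n \<Rightarrow> (real^'n) measure" where
  "wos_step s r X = (if X \<in> ball 0 r then wos_kernel s r X else return lborel X)"

fun wos_law :: "real \<Rightarrow> real \<Rightarrow> real^'n \<Rightarrow> nat \<Rightarrow> (real^'n) measure" where
  "wos_law s r x0 0 = return lborel x0"
| "wos_law s r x0 (Suc k) = wos_law s r x0 k \<bind> wos_step s r"

text \<open>E(l) for l = min{k \<ge> 1. X_k \<notin> B_r}, via E(l) = sum_k P(l > k) and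
  P(l > k) = P(stopped X_k \<in> B_r) (as x0 \<in> B_r).\<close>
definition wos_expected_steps :: "real \<Rightarrow> real \<Rightarrow> real^'n \<Rightarrow> ennreal" where
  "wos_expected_steps s r x0 = (\<Sum>k. emeasure (wos_law s r x0 k) (ball 0 r))"

definition C4 :: "nat \<Rightarrow> real \<Rightarrow> real" where
  "C4 n s = pi powr (- (real n / 2)) / Gamma s *
     max ((2 powr (2 * s)) * Gamma (real n / 2) / Gamma (1 + s)) (Gamma (real n / 2 - s))"

definition s1_of :: "real \<Rightarrow> real" where
  "s1_of s = (if s \<le> 1/3 then s else (1 - s) / 2)"

definition gamma_of :: "nat \<Rightarrow> real \<Rightarrow> real" where
  "gamma_of n s = (1 + s1_of s + s) * (s1_of s - real n) / (1 - s1_of s - s) + real n"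

text \<open>Right-hand side of the bound, with t = |x0|.\<close>
definition wos_bound :: "nat \<Rightarrow> real \<Rightarrow> real \<Rightarrow> real \<Rightarrow> real" where
  "wos_bound n s r t = (let s1 = s1_of s; q = 1 + s1 + s; g = gamma_of n s in
     2 powr (4 * s + 1) * pi powr (real n / 2) * Gamma (s + real n / 2) * Gamma (s + 1)
       / (Gamma (real n / 2))\<^sup>2 * C4 n s *
     (2 powr s / s1 + (r - t) powr s *
        (r powr (real n - q / 2) * Beta (1 - q / 2) (real n)) powr (2 * (s1 + s) / q) *
        ((1 / g) * ((r + t) powr g - ((r - t) / 2) powr g)) powr ((1 - s1 - s) / q)))"

end

theory Submission
  imports Defs
begin

text \<open>
  From \<open>X\<close> in the ball the chain jumps by \<open>r - |X|\<close> times a rotation invariant unit jump. The ball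
  lies in the halfspace tangent to it at the boundary point nearest to \<open>X\<close>, so the chain leaves the
  ball with probability at least that of the unit jump entering \<open>{z. z \<bullet> e \<ge> 1}\<close>, which does not
  depend on \<open>X\<close>. Hence the number of steps is dominated by a geometric variable, and the reciprocal of
  an explicit lower bound for this probability is already below the first summand of the bound.

  For the monotonicity put \<open>q = 1 + s\<^sub>1 + s\<close>, \<open>\<theta> = 2 (s\<^sub>1 + s) / q\<close>, \<open>p = 1 - \<theta>\<close>,
  \<open>g = - \<gamma> > 0\<close>, \<open>x = ln (2 r / (r - t))\<close> and \<open>\<Lambda> = ln (2 (r + t) / (r - t))\<close>. Since
  \<open>p g = n \<theta> - s\<^sub>1\<close>, the second summand is
  \<open>B\<^sup>\<theta> 2\<^sup>s exp ((n \<theta> - s\<^sub>1 - s) x) ((1 - exp (- g \<Lambda>)) / g)\<^sup>p\<close>, which is visibly increasing in \<open>t\<close>. For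
  the dependence on \<open>s\<close>, the factor \<open>(n B)\<^sup>\<theta>\<close> and the Gamma factors are increasing by log-convexity
  of Gamma, and what remains has a nonnegative logarithmic derivative on both sides of \<open>s = 1/3\<close>.
\<close>

section \<open>Lebesgue integrals of radial functions and over halfspaces\<close>

lemma nn_integral_lborel_affine:
  fixes f :: "'a::euclidean_space \<Rightarrow> ennreal"
  assumes [measurable]: "f \<in> borel_measurable borel" and "c \<noteq> 0"
  shows "(\<integral>\<^sup>+x. f x \<partial>lborel) = ennreal (\<bar>c\<bar> ^ DIM('a)) * (\<integral>\<^sup>+x. f (t + c *\<^sub>R x) \<partial>lborel)"
  by (subst lborel_affine[OF \<open>c \<noteq> 0\<close>, of t])
     (simp add: nn_integral_density nn_integral_distr nn_integral_cmult)

text \<open>Haar uniqueness: smear over the unit ball, which is \<open>T\<close>-invariant, and apply Fubini.\<close>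

lemma nn_integral_lborel_orthogonal:
  fixes f :: "'a::euclidean_space \<Rightarrow> ennreal" and T :: "'a \<Rightarrow> 'a"
  assumes [measurable]: "f \<in> borel_measurable borel" and T: "orthogonal_transformation T"
  shows "(\<integral>\<^sup>+x. f (T x) \<partial>lborel) = (\<integral>\<^sup>+x. f x \<partial>lborel)"
proof -
  have lin: "linear T" using T by (rule orthogonal_transformation_linear)
  have [measurable]: "T \<in> borel_measurable borel"
    by (intro borel_measurable_continuous_onI linear_continuous_on linear_conv_bounded_linear[THEN iffD1] lin)
  have surj: "surj T"
    using T lin by (intro linear_injective_imp_surjective orthogonal_transformation_inj) auto
  have iso: "dist (T a) (T b) = dist a b" for a b
    using T by (metis lin dist_norm linear_diff orthogonal_transformation_norm)
  define V where "V = emeasure lborel (ball (0::'a) 1)"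
  have V: "V = ennreal (unit_ball_vol DIM('a))" unfolding V_def by (simp add: emeasure_ball)
  then have V0: "V \<noteq> 0" "V \<noteq> \<infinity>" by (auto simp: ennreal_eq_0_iff unit_ball_vol_pos not_le)
  have ballV: "emeasure lborel (ball a 1) = V" for a :: 'a by (simp add: V emeasure_ball)
  let ?B = "\<lambda>y::'a. indicator {..<1} (norm y) :: ennreal"
  have ind: "?B (y - z) = indicator (ball z 1) y" for y z :: 'a
    by (simp add: indicator_def dist_norm norm_minus_commute)
  have shift: "(\<integral>\<^sup>+x. h (a + x) \<partial>lborel) = (\<integral>\<^sup>+x. h x \<partial>lborel)"
    if [measurable]: "h \<in> borel_measurable borel" for h :: "'a \<Rightarrow> ennreal" and a
    using nn_integral_lborel_affine[of h 1 a] by simp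
  have "V * (\<integral>\<^sup>+x. f (T x) \<partial>lborel) = (\<integral>\<^sup>+y. ?B y * (\<integral>\<^sup>+x. f (T x) \<partial>lborel) \<partial>lborel)"
  proof -
    have "(\<integral>\<^sup>+y. ?B y \<partial>lborel) = V"
      using ind[of _ 0] by (simp add: V_def)
    then show ?thesis by (subst nn_integral_multc) auto
  qed
  \<comment> \<open>Translating \<open>x\<close> by a preimage of \<open>y\<close> under
    \<open>T\<close> leaves the inner integral unchanged.\<close>
  also have "\<dots> = (\<integral>\<^sup>+y. ?B y * (\<integral>\<^sup>+x. f (y + T x) \<partial>lborel) \<partial>lborel)"
  proof (rule nn_integral_cong)
    fix y
    obtain y' where "y = T y'" using surj by auto
    then have "(\<integral>\<^sup>+x. f (y + T x) \<partial>lborel) = (\<integral>\<^sup>+x. f (T (y' + x)) \<partial>lborel)"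
      by (simp add: linear_add[OF lin])
    then show "?B y * (\<integral>\<^sup>+x. f (T x) \<partial>lborel) = ?B y * (\<integral>\<^sup>+x. f (y + T x) \<partial>lborel)"
      using shift[of "\<lambda>x. f (T x)" y'] by simp
  qed
  also have "\<dots> = (\<integral>\<^sup>+y. (\<integral>\<^sup>+x. ?B y * f (y + T x) \<partial>lborel) \<partial>lborel)"
    by (simp add: nn_integral_cmult)
  also have "\<dots> = (\<integral>\<^sup>+x. (\<integral>\<^sup>+y. ?B y * f (y + T x) \<partial>lborel) \<partial>lborel)"
    by (rule lborel_pair.Fubini') measurable
  also have "\<dots> = (\<integral>\<^sup>+x. (\<integral>\<^sup>+y. ?B (y - T x) * f y \<partial>lborel) \<partial>lborel)"
  proof (rule nn_integral_cong)
    fix x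
    show "(\<integral>\<^sup>+y. ?B y * f (y + T x) \<partial>lborel) = (\<integral>\<^sup>+y. ?B (y - T x) * f y \<partial>lborel)"
      by (subst shift[of "\<lambda>y. ?B (y - T x) * f y" "T x", symmetric]) (simp_all add: add.commute)
  qed
  also have "\<dots> = (\<integral>\<^sup>+y. (\<integral>\<^sup>+x. ?B (y - T x) * f y \<partial>lborel) \<partial>lborel)"
    by (rule lborel_pair.Fubini') measurable
  also have "\<dots> = (\<integral>\<^sup>+y. V * f y \<partial>lborel)"
  proof (rule nn_integral_cong)
    fix y
    obtain y' where y': "y = T y'" using surj by auto
    \<comment> \<open>\<open>T\<close> is an isometry and \<open>y = T y'\<close>, so for fixed
      \<open>y\<close> the admissible \<open>x\<close> form the unit ball about \<open>y'\<close>,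
      which again has volume \<open>V\<close>.\<close>
    have "?B (y - T x) = indicator (ball y' 1) x" for x
      using iso[of x y'] by (simp add: ind) (simp add: y' indicator_def dist_commute)
    then show "(\<integral>\<^sup>+x. ?B (y - T x) * f y \<partial>lborel) = V * f y"
      by (subst nn_integral_multc) (auto intro!: borel_measurable_indicator simp: nn_integral_multc ballV)
  qed
  also have "\<dots> = V * (\<integral>\<^sup>+x. f x \<partial>lborel)"
    by (simp add: nn_integral_cmult)
  finally show ?thesis using V0 by (simp add: ennreal_mult_cancel_left)
qed

text \<open>Two measures on the line that agree and are finite on all rays \<open>{v<..}\<close>
  coincide. The norm enters negated so that the preimage of such a ray is a ball, of finite and
  known volume; a reflection at the end restores the usual radial variable.\<close>

lemma nn_integral_lborel_norm:
  fixes f :: "real \<Rightarrow> ennreal"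
  assumes [measurable]: "f \<in> borel_measurable borel"
  shows "(\<integral>\<^sup>+x. f (norm (x::'a::euclidean_space)) \<partial>lborel) =
    (\<integral>\<^sup>+\<rho>. ennreal (real DIM('a) * unit_ball_vol DIM('a) * \<rho> ^ (DIM('a) - 1)) * indicator {0..} \<rho> * f \<rho> \<partial>lborel)"
proof -
  define n where "n = DIM('a)"
  have n: "n \<ge> 1" using DIM_positive[where 'a='a] by (simp add: n_def)
  define w :: "real \<Rightarrow> ennreal" where
    "w = (\<lambda>v. ennreal (real n * unit_ball_vol n * (- v) ^ (n - 1)) * indicator {..0} v)"
  have [measurable]: "w \<in> borel_measurable borel" unfolding w_def by measurable
  have "distr lborel borel (\<lambda>x::'a. - norm x) = density lborel w"
  proof (rule measure_eqI_lessThan)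
    have eq1: "emeasure (distr lborel borel (\<lambda>x::'a. - norm x)) {v<..} = ennreal (unit_ball_vol n * (max 0 (- v)) ^ n)" for v
    proof -
      have "emeasure (distr lborel borel (\<lambda>x::'a. - norm x)) {v<..} = emeasure lborel (ball (0::'a) (- v))"
        by (subst emeasure_distr) (auto intro!: arg_cong[where f="emeasure lborel"])
      \<comment> \<open>For \<open>v \<ge> 0\<close> the ball is empty, and \<open>max\<close>
        yields \<open>0 ^ n\<close>, which vanishes since \<open>n \<ge> 1\<close>.\<close>
      also have "\<dots> = ennreal (unit_ball_vol n * (max 0 (- v)) ^ n)"
        using n by (cases "v \<ge> 0") (auto simp: emeasure_ball n_def max_def ball_empty)
      finally show ?thesis .
    qed
    show "emeasure (distr lborel borel (\<lambda>x::'a. - norm x)) {v<..} < \<infinity>" for v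
      by (simp add: eq1)
    show "emeasure (distr lborel borel (\<lambda>x::'a. - norm x)) {v<..} = emeasure (density lborel w) {v<..}" for v
    proof (cases "v \<ge> 0")
      case True
      then have "(\<lambda>u. w u * indicator {v<..} u) = (\<lambda>_. 0)"
        by (auto simp: w_def indicator_def)
      then have "emeasure (density lborel w) {v<..} = 0"
        by (simp add: emeasure_density)
      then show ?thesis using True n by (simp add: eq1 max_def)
    next
      case False
      have "emeasure (density lborel w) {v<..} =
          (\<integral>\<^sup>+u. ennreal (real n * unit_ball_vol n * (- u) ^ (n - 1)) * indicator {v..0} u \<partial>lborel)"
      proof -
        have "AE u in lborel. w u * indicator {v<..} u =
            ennreal (real n * unit_ball_vol n * (- u) ^ (n - 1)) * indicator {v..0} u"
          using AE_lborel_singleton[of v] by eventually_elim (auto simp: w_def indicator_def)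
        then show ?thesis by (simp add: emeasure_density nn_integral_cong_AE)
      qed
      also have "\<dots> = ennreal (- unit_ball_vol n * (- 0) ^ n - (- unit_ball_vol n * (- v) ^ n))"
      proof (rule nn_integral_FTC_Icc)
        show "((\<lambda>u. - unit_ball_vol n * (- u) ^ n) has_real_derivative
            real n * unit_ball_vol n * (- u) ^ (n - 1)) (at u)" for u
          by (auto intro!: derivative_eq_intros simp: algebra_simps)
        show "0 \<le> real n * unit_ball_vol n * (- u) ^ (n - 1)" if "u \<in> {v..0}" for u
          using that by simp
      qed (use False in auto)
      finally show ?thesis using False n by (simp add: eq1 max_def)
    qed
  qed simp_all
  then have "(\<integral>\<^sup>+v. f (- v) \<partial>distr lborel borel (\<lambda>x::'a. - norm x)) = (\<integral>\<^sup>+v. f (- v) \<partial>density lborel w)"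
    by simp
  then have "(\<integral>\<^sup>+x. f (norm (x::'a)) \<partial>lborel) = (\<integral>\<^sup>+v. w v * f (- v) \<partial>lborel)"
    by (simp add: nn_integral_distr nn_integral_density)
  also have "\<dots> = (\<integral>\<^sup>+v. w (- v) * f v \<partial>lborel)"
    using nn_integral_lborel_affine[of "\<lambda>v. w v * f (- v)" "-1" 0] by simp
  finally show ?thesis
    by (simp add: w_def n_def indicator_def)
qed

section \<open>Gaussian integrals and powers of the norm over halfspaces\<close>

lemma nn_integral_gaussian:
  assumes "\<tau> > 0"
  shows "(\<integral>\<^sup>+y. ennreal (exp (- \<tau> * y\<^sup>2)) \<partial>lborel) = ennreal (sqrt (pi / \<tau>))"
proof -
  define \<sigma> where "\<sigma> = sqrt (1 / (2 * \<tau>))"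
  have \<sigma>: "\<sigma> > 0" "\<sigma>\<^sup>2 = 1 / (2 * \<tau>)" using assms by (auto simp: \<sigma>_def)
  have eq: "exp (- \<tau> * y\<^sup>2) = sqrt (pi / \<tau>) * normal_density 0 \<sigma> y" for y
    using assms by (simp add: normal_density_def \<sigma> real_sqrt_divide)
  have "(\<integral>\<^sup>+y. ennreal (exp (- \<tau> * y\<^sup>2)) \<partial>lborel) =
      ennreal (sqrt (pi / \<tau>)) * (\<integral>\<^sup>+y. ennreal (normal_density 0 \<sigma> y) \<partial>lborel)"
    using assms by (simp only: eq ennreal_mult' ) (simp add: nn_integral_cmult ennreal_mult')
  also have "(\<integral>\<^sup>+y. ennreal (normal_density 0 \<sigma> y) \<partial>lborel) = 1"
    using \<sigma> by (simp add: nn_integral_eq_integral)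
  finally show ?thesis by simp
qed

text \<open>Substitution \<open>\<tau> = t / c\<close> in Euler's integral. It is read below once
  with \<open>c = (norm z)^2\<close>, to produce a power of the norm, and once with
  \<open>c = y^2\<close>, to evaluate what remains.\<close>

lemma nn_integral_Gamma_scaled:
  assumes "a > 0" and "c > 0"
  shows "(\<integral>\<^sup>+\<tau>. ennreal (indicator {0..} \<tau> * \<tau> powr (a - 1) * exp (- \<tau> * c)) \<partial>lborel) =
    ennreal (Gamma a * c powr (- a))"
proof -
  have "(\<integral>\<^sup>+\<tau>. ennreal (indicator {0..} \<tau> * \<tau> powr (a - 1) * exp (- \<tau> * c)) \<partial>lborel) =
     ennreal (1 / c) * (\<integral>\<^sup>+t. ennreal (indicator {0..} (t / c) * (t / c) powr (a - 1) * exp (- (t / c) * c)) \<partial>lborel)"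
    using nn_integral_lborel_affine[of "\<lambda>\<tau>. ennreal (indicator {0..} \<tau> * \<tau> powr (a - 1) * exp (- \<tau> * c))" "1 / c" 0] assms
    by simp
  also have "\<dots> = (\<integral>\<^sup>+t. ennreal (c powr (- a)) * ennreal (indicator {0..} t * t powr (a - 1) / exp t) \<partial>lborel)"
    using assms
    by (subst nn_integral_cmult[symmetric], simp, intro nn_integral_cong)
       (auto simp: ennreal_mult'[symmetric] indicator_def powr_divide exp_minus divide_simps powr_diff powr_minus
        intro!: arg_cong[where f=ennreal])
  also have "\<dots> = ennreal (Gamma a * c powr (- a))"
    using assms
    by (subst nn_integral_cmult, simp)
       (simp only: Gamma_conv_nn_integral_real[symmetric], simp add: ennreal_mult'[symmetric] mult.commute)
  finally show ?thesis .
qed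

text \<open>The Gaussian factorises over the coordinates. Only the factor for \<open>e\<close>
  carries the halfspace constraint; the other \<open>DIM('a) - 1\<close> factors are full Gaussian
  integrals.\<close>

lemma nn_integral_gaussian_halfspace:
  fixes e :: "'a::euclidean_space"
  assumes "\<tau> > 0" and e: "e \<in> Basis"
  shows "(\<integral>\<^sup>+z. indicator {1..} (z \<bullet> e) * ennreal (exp (- \<tau> * (norm z)\<^sup>2)) \<partial>lborel) =
    ennreal (sqrt (pi / \<tau>) ^ (DIM('a) - 1)) * (\<integral>\<^sup>+y. indicator {1..} y * ennreal (exp (- \<tau> * y\<^sup>2)) \<partial>lborel)"
proof -
  define f :: "'a \<Rightarrow> real \<Rightarrow> ennreal" where
    "f = (\<lambda>b y. ennreal (exp (- \<tau> * y\<^sup>2)) * (if b = e then indicator {1..} y else 1))"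
  have [measurable]: "f b \<in> borel_measurable borel" for b
    unfolding f_def by (cases "b = e") auto
  have "indicator {1..} (z \<bullet> e) * ennreal (exp (- \<tau> * (norm z)\<^sup>2)) = (\<Prod>b\<in>Basis. f b (z \<bullet> b))" for z
  proof -
    have "(\<Prod>b\<in>Basis. f b (z \<bullet> b)) =
        (\<Prod>b\<in>Basis. ennreal (exp (- \<tau> * (z \<bullet> b)\<^sup>2))) * (\<Prod>b\<in>Basis. if b = e then indicator {1..} (z \<bullet> b) else 1)"
      by (simp add: f_def prod.distrib)
    also have "(\<Prod>b\<in>Basis. ennreal (exp (- \<tau> * (z \<bullet> b)\<^sup>2))) = ennreal (exp (- \<tau> * (norm z)\<^sup>2))"
    proof -
      have "(norm z)\<^sup>2 = (\<Sum>b\<in>Basis. (z \<bullet> b)\<^sup>2)"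
        unfolding power2_norm_eq_inner by (subst euclidean_inner) (simp add: power2_eq_square)
      then show ?thesis
        by (simp add: prod_ennreal exp_sum[symmetric] sum_distrib_left sum_negf)
    qed
    also have "(\<Prod>b\<in>Basis. if b = e then indicator {1..} (z \<bullet> b) else 1) = (indicator {1..} (z \<bullet> e) :: ennreal)"
      using e by (subst prod.delta) auto
    finally show ?thesis by (simp add: mult.commute)
  qed
  then have "(\<integral>\<^sup>+z. indicator {1..} (z \<bullet> e) * ennreal (exp (- \<tau> * (norm z)\<^sup>2)) \<partial>lborel) =
      (\<Prod>b\<in>Basis. (\<integral>\<^sup>+y. f b y \<partial>lborel))"
    by (simp add: nn_integral_lborel_prod)
  also have "\<dots> = (\<integral>\<^sup>+y. f e y \<partial>lborel) * (\<Prod>b\<in>Basis - {e}. (\<integral>\<^sup>+y. f b y \<partial>lborel))"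
    using e by (simp add: prod.remove)
  also have "(\<Prod>b\<in>Basis - {e}. (\<integral>\<^sup>+y. f b y \<partial>lborel)) = (\<Prod>b\<in>Basis - {e}. ennreal (sqrt (pi / \<tau>)))"
    using nn_integral_gaussian[OF assms(1)] by (intro prod.cong) (auto simp: f_def)
  also have "\<dots> = ennreal (sqrt (pi / \<tau>) ^ (DIM('a) - 1))"
    using e assms by (simp add: ennreal_power)
  finally show ?thesis by (simp add: f_def mult.commute)
qed

text \<open>Writing \<open>norm z powr - (n + 2 s)\<close> as a Gamma integral of Gaussians makes the integrand a product
  over the coordinates.\<close>

lemma nn_integral_powr_halfspace_Basis:
  fixes e :: "'a::euclidean_space" and s :: real
  assumes "s > 0" and e: "e \<in> Basis"
  shows "(\<integral>\<^sup>+z. indicator {1..} (z \<bullet> e) * ennreal (norm z powr - (real DIM('a) + 2 * s)) \<partial>lborel) =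
    ennreal (pi powr ((real DIM('a) - 1) / 2) * Gamma (s + 1/2) / (2 * s * Gamma (DIM('a) / 2 + s)))"
proof -
  define n where "n = DIM('a)"
  have n: "n \<ge> 1" using DIM_positive[where 'a='a] by (simp add: n_def)
  define a where "a = real n / 2 + s"
  have a: "a > 0" using assms n by (simp add: a_def)
  then have Ga: "Gamma a > 0" by simp
  define h where "h = (\<lambda>\<tau>. indicator {0..} \<tau> * \<tau> powr (a - 1) :: real)"
  have h0: "h \<tau> \<ge> 0" for \<tau> by (simp add: h_def)
  have [measurable]: "h \<in> borel_measurable borel" unfolding h_def by measurable
  have Gk: "(\<integral>\<^sup>+\<tau>. ennreal (h \<tau>) * ennreal (exp (- \<tau> * c)) \<partial>lborel) = ennreal (Gamma a * c powr (- a))" if "c > 0" for c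
    using nn_integral_Gamma_scaled[OF a that] by (simp add: h_def ennreal_mult'[symmetric])
  have "ennreal (Gamma a) * (\<integral>\<^sup>+z. indicator {1..} (z \<bullet> e) * ennreal (norm z powr - (real n + 2 * s)) \<partial>lborel) =
     (\<integral>\<^sup>+z. indicator {1..} (z \<bullet> e) * ennreal (Gamma a * norm z powr - (real n + 2 * s)) \<partial>lborel)"
    using Ga by (subst nn_integral_cmult[symmetric]) (auto simp: ennreal_mult' mult_ac)
  also have "\<dots> = (\<integral>\<^sup>+z. (\<integral>\<^sup>+\<tau>. indicator {1..} (z \<bullet> e) * (ennreal (h \<tau>) * ennreal (exp (- \<tau> * (norm z)\<^sup>2))) \<partial>lborel) \<partial>lborel)"
  proof (rule nn_integral_cong)
    fix z :: 'a
    show "indicator {1..} (z \<bullet> e) * ennreal (Gamma a * norm z powr - (real n + 2 * s)) =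
      (\<integral>\<^sup>+\<tau>. indicator {1..} (z \<bullet> e) * (ennreal (h \<tau>) * ennreal (exp (- \<tau> * (norm z)\<^sup>2))) \<partial>lborel)"
    proof (cases "z \<bullet> e \<ge> 1")
      case True
      then have z: "norm z > 0" by auto
      then have "norm z powr - (real n + 2 * s) = ((norm z)\<^sup>2) powr (- a)"
      proof -
        have "norm z powr (2 * - a) = (norm z powr 2) powr (- a)"
          by (rule powr_powr[symmetric])
        moreover have "2 * - a = - (real n + 2 * s)" by (simp add: a_def)
        ultimately show ?thesis using z by simp
      qed
      then show ?thesis using Gk[of "(norm z)\<^sup>2"] z by (simp add: nn_integral_cmult)
    qed simp
  qed
  also have "\<dots> = (\<integral>\<^sup>+\<tau>. (\<integral>\<^sup>+z. indicator {1..} (z \<bullet> e) * (ennreal (h \<tau>) * ennreal (exp (- \<tau> * (norm z)\<^sup>2))) \<partial>lborel) \<partial>lborel)"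
    by (rule lborel_pair.Fubini') measurable
  also have "\<dots> = (\<integral>\<^sup>+\<tau>. (\<integral>\<^sup>+y. indicator {1..} y * (ennreal (h \<tau> * sqrt (pi / \<tau>) ^ (n - 1)) * ennreal (exp (- \<tau> * y\<^sup>2))) \<partial>lborel) \<partial>lborel)"
  proof (rule nn_integral_cong_AE, rule AE_mp[OF AE_lborel_singleton[of 0]], intro AE_I2 impI)
    fix \<tau> :: real assume "\<tau> \<noteq> 0"
    show "(\<integral>\<^sup>+z. indicator {1..} (z \<bullet> e) * (ennreal (h \<tau>) * ennreal (exp (- \<tau> * (norm z)\<^sup>2))) \<partial>lborel) =
      (\<integral>\<^sup>+y. indicator {1..} y * (ennreal (h \<tau> * sqrt (pi / \<tau>) ^ (n - 1)) * ennreal (exp (- \<tau> * y\<^sup>2))) \<partial>lborel)"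
    proof (cases "\<tau> > 0")
      case True
      have "(\<integral>\<^sup>+z. indicator {1..} (z \<bullet> e) * (ennreal (h \<tau>) * ennreal (exp (- \<tau> * (norm z)\<^sup>2))) \<partial>lborel) =
        ennreal (h \<tau>) * (\<integral>\<^sup>+z. indicator {1..} (z \<bullet> e) * ennreal (exp (- \<tau> * (norm z)\<^sup>2)) \<partial>lborel)"
        by (subst nn_integral_cmult[symmetric]) (auto simp: mult_ac)
      also have "\<dots> = ennreal (h \<tau> * sqrt (pi / \<tau>) ^ (n - 1)) * (\<integral>\<^sup>+y. indicator {1..} y * ennreal (exp (- \<tau> * y\<^sup>2)) \<partial>lborel)"
        using True h0[of \<tau>]
        by (subst nn_integral_gaussian_halfspace[OF True e]) (simp add: n_def ennreal_mult' mult.assoc)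
      also have "\<dots> = (\<integral>\<^sup>+y. indicator {1..} y * (ennreal (h \<tau> * sqrt (pi / \<tau>) ^ (n - 1)) * ennreal (exp (- \<tau> * y\<^sup>2))) \<partial>lborel)"
        by (subst nn_integral_cmult[symmetric]) (auto simp: mult_ac)
      finally show ?thesis .
    next
      case False
      then have "h \<tau> = 0" using \<open>\<tau> \<noteq> 0\<close> by (simp add: h_def)
      then show ?thesis by simp
    qed
  qed
  \<comment> \<open>The order is swapped once more so that the \<open>\<tau>\<close> integral can be
    evaluated for each fixed \<open>y\<close>, leaving a power of \<open>y\<close>.\<close>
  also have "\<dots> = (\<integral>\<^sup>+y. (\<integral>\<^sup>+\<tau>. indicator {1..} y * (ennreal (h \<tau> * sqrt (pi / \<tau>) ^ (n - 1)) * ennreal (exp (- \<tau> * y\<^sup>2))) \<partial>lborel) \<partial>lborel)"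
    by (rule lborel_pair.Fubini') measurable
  also have "\<dots> = (\<integral>\<^sup>+y. ennreal (pi powr ((real n - 1) / 2) * Gamma (s + 1/2)) * (ennreal (y powr - (2 * s + 1)) * indicator {1..} y) \<partial>lborel)"
  proof (rule nn_integral_cong)
    fix y :: real
    show "(\<integral>\<^sup>+\<tau>. indicator {1..} y * (ennreal (h \<tau> * sqrt (pi / \<tau>) ^ (n - 1)) * ennreal (exp (- \<tau> * y\<^sup>2))) \<partial>lborel) =
      ennreal (pi powr ((real n - 1) / 2) * Gamma (s + 1/2)) * (ennreal (y powr - (2 * s + 1)) * indicator {1..} y)"
    proof (cases "y \<ge> 1")
      case True
      \<comment> \<open>The \<open>n - 1\<close> full Gaussians contribute
        \<open>\<tau> powr - ((n - 1) / 2)\<close>, which lowers the exponent \<open>a - 1\<close>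
        to \<open>s - 1/2\<close>; the remaining integral is again of Gamma type, with parameter
        \<open>s + 1/2\<close>.\<close>
      have hs: "h \<tau> * sqrt (pi / \<tau>) ^ (n - 1) =
          pi powr ((real n - 1) / 2) * (indicator {0..} \<tau> * \<tau> powr ((s + 1/2) - 1))" if "\<tau> \<noteq> 0" for \<tau>
      proof (cases "\<tau> > 0")
        case True
        have "sqrt (pi / \<tau>) ^ (n - 1) = (pi / \<tau>) powr (real (n - 1) / 2)"
          using True by (simp add: powr_half_sqrt[symmetric] powr_powr powr_realpow[symmetric])
        also have "\<dots> = pi powr ((real n - 1) / 2) * \<tau> powr (- ((real n - 1) / 2))"
          using True n by (simp add: powr_divide of_nat_diff powr_minus_divide)
        finally have eq: "sqrt (pi / \<tau>) ^ (n - 1) = pi powr ((real n - 1) / 2) * \<tau> powr (- ((real n - 1) / 2))" .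
        show ?thesis
        proof -
          have "(a - 1) + - ((real n - 1) / 2) = s + 1/2 - 1" by (simp add: a_def field_simps)
          then have "\<tau> powr (a - 1) * \<tau> powr (- ((real n - 1) / 2)) = \<tau> powr (s + 1/2 - 1)"
            by (simp only: powr_add[symmetric])
          then show ?thesis using True by (simp only: h_def eq) (simp add: mult.left_commute)
        qed
      qed (use that in \<open>auto simp: h_def\<close>)
      have "(\<integral>\<^sup>+\<tau>. ennreal (h \<tau> * sqrt (pi / \<tau>) ^ (n - 1)) * ennreal (exp (- \<tau> * y\<^sup>2)) \<partial>lborel) =
         (\<integral>\<^sup>+\<tau>. ennreal (pi powr ((real n - 1) / 2)) * ennreal (indicator {0..} \<tau> * \<tau> powr ((s + 1/2) - 1) * exp (- \<tau> * y\<^sup>2)) \<partial>lborel)"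
      proof (intro nn_integral_cong_AE)
        show "AE \<tau> in lborel. ennreal (h \<tau> * sqrt (pi / \<tau>) ^ (n - 1)) * ennreal (exp (- \<tau> * y\<^sup>2)) =
          ennreal (pi powr ((real n - 1) / 2)) * ennreal (indicator {0..} \<tau> * \<tau> powr ((s + 1/2) - 1) * exp (- \<tau> * y\<^sup>2))"
          using AE_lborel_singleton[of 0]
        proof eventually_elim
          case (elim \<tau>)
          show ?case
            by (simp only: hs[OF elim]) (simp add: ennreal_mult'[symmetric] mult.assoc)
        qed
      qed
      also have "\<dots> = ennreal (pi powr ((real n - 1) / 2)) * ennreal (Gamma (s + 1/2) * (y\<^sup>2) powr - (s + 1/2))"
        using True assms by (subst nn_integral_cmult, simp, subst nn_integral_Gamma_scaled) auto
      also have "(y\<^sup>2) powr - (s + 1/2) = y powr - (2 * s + 1)"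
      proof -
        have "y powr (2 * - (s + 1/2)) = (y powr 2) powr - (s + 1/2)"
          by (rule powr_powr[symmetric])
        moreover have "2 * - (s + 1/2) = - (2 * s + 1)" by simp
        ultimately show ?thesis using True by simp
      qed
      finally show ?thesis using True assms
        by (simp add: ennreal_mult'[symmetric] mult.assoc)
    qed simp
  qed
  also have "\<dots> = ennreal (pi powr ((real n - 1) / 2) * Gamma (s + 1/2)) * (\<integral>\<^sup>+y. ennreal (y powr - (2 * s + 1)) * indicator {1..} y \<partial>lborel)"
    by (rule nn_integral_cmult) measurable
  also have "(\<integral>\<^sup>+y. ennreal (y powr - (2 * s + 1)) * indicator {1..} y \<partial>lborel) =
      ennreal (0 - (- (1 powr - (2 * s)) / (2 * s)))"
  proof (intro nn_integral_FTC_atLeast)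
    show "((\<lambda>y. - (y powr - (2 * s)) / (2 * s)) has_real_derivative y powr - (2 * s + 1)) (at y)" if "1 \<le> y" for y
    proof -
      have "- (2 * s + 1) = - (2 * s) - 1" by simp
      then show ?thesis
        using that assms by (simp only:) (auto intro!: derivative_eq_intros)
    qed
    have "((\<lambda>y::real. y powr - (2 * s)) \<longlongrightarrow> 0) at_top"
      using assms by (intro tendsto_neg_powr filterlim_ident) auto
    from tendsto_divide[OF tendsto_minus[OF this] tendsto_const, of "2 * s"] assms
    show "((\<lambda>y. - (y powr - (2 * s)) / (2 * s)) \<longlongrightarrow> 0) at_top"
      by simp
  qed auto
  finally have eq: "ennreal (Gamma a) * (\<integral>\<^sup>+z. indicator {1..} (z \<bullet> e) * ennreal (norm z powr - (real n + 2 * s)) \<partial>lborel) =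
      ennreal (Gamma a) * ennreal (pi powr ((real n - 1) / 2) * Gamma (s + 1/2) / (2 * s * Gamma a))"
    using Ga assms by (simp add: ennreal_mult'[symmetric])
  then show ?thesis
    using Ga by (subst (asm) ennreal_mult_cancel_left) (auto simp: n_def a_def)
qed

text \<open>A rotation carrying a coordinate vector to \<open>e\<close> preserves Lebesgue measure
  and the norm, which reduces the claim to a coordinate halfspace.\<close>

lemma nn_integral_powr_halfspace:
  fixes e :: "real^'n" and s :: real
  assumes "s > 0" and e: "norm e = 1"
  shows "(\<integral>\<^sup>+z. indicator {1..} (z \<bullet> e) * ennreal (norm z powr - (real CARD('n) + 2 * s)) \<partial>lborel) =
    ennreal (pi powr ((real CARD('n) - 1) / 2) * Gamma (s + 1/2) / (2 * s * Gamma (CARD('n) / 2 + s)))"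
proof -
  obtain b :: "real^'n" where b: "b \<in> Basis" using nonempty_Basis by blast
  then obtain T where T: "orthogonal_transformation T" "T b = e"
    using orthogonal_transformation_exists[of b e] e by auto
  have "(\<integral>\<^sup>+z. indicator {1..} (z \<bullet> e) * ennreal (norm z powr - (real CARD('n) + 2 * s)) \<partial>lborel) =
      (\<integral>\<^sup>+z. indicator {1..} (T z \<bullet> e) * ennreal (norm (T z) powr - (real CARD('n) + 2 * s)) \<partial>lborel)"
    by (rule nn_integral_lborel_orthogonal[OF _ T(1), symmetric]) measurable
  also have "\<dots> = (\<integral>\<^sup>+z. indicator {1..} (z \<bullet> b) * ennreal (norm z powr - (real CARD('n) + 2 * s)) \<partial>lborel)"
  proof -
    have "T z \<bullet> e = z \<bullet> b" for z
      using T by (auto simp: orthogonal_transformation_def)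
    then show ?thesis
      by (simp add: orthogonal_transformation_norm[OF T(1)])
  qed
  finally show ?thesis
    using nn_integral_powr_halfspace_Basis[OF assms(1) b] by simp
qed

section \<open>Reflection formula and the radial normalising integral\<close>

lemma Gamma_reflection_real:
  fixes s :: real
  assumes "0 < s" "s < 1"
  shows "Gamma s * Gamma (1 - s) = pi / sin (pi * s)"
proof -
  have "complex_of_real (Gamma s * Gamma (1 - s)) = of_real (pi / sin (pi * s))"
    using Gamma_reflection_complex[of "of_real s"] assms
    by (simp add: Gamma_complex_of_real[symmetric] sin_of_real[symmetric] del: sin_of_real)
  then show ?thesis by (simp only: of_real_eq_iff)
qed

text \<open>With \<open>\<rho> = (1 - u) powr (- 1/2)\<close>, that is
  \<open>u = 1 - 1 / \<rho>^2\<close>, the integral becomes half of the Euler integral for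
  \<open>Beta (1 - s) s\<close>, which the reflection formula evaluates.\<close>

lemma nn_integral_wos_radial:
  assumes s: "0 < s" "s < 1"
  shows "(\<integral>\<^sup>+\<rho>. indicator {1<..} \<rho> * ennreal ((\<rho>\<^sup>2 - 1) powr (- s) / \<rho>) \<partial>lborel) = ennreal (pi / (2 * sin (pi * s)))"
proof -
  define f where "f = (\<lambda>\<rho>::real. (\<rho>\<^sup>2 - 1) powr (- s) / \<rho>)"
  define g where "g = (\<lambda>u::real. (1 - u) powr (- 1 / 2))"
  define g' where "g' = (\<lambda>u::real. (1 - u) powr (- 3 / 2) / 2)"
  let ?S = "{0<..<1::real}"
  have gsq: "(g u)\<^sup>2 = 1 / (1 - u)" if "u < 1" for u
  proof -
    have "(g u)\<^sup>2 = g u powr 2" using that by (simp add: g_def)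
    also have "\<dots> = (1 - u) powr (- 1)" unfolding g_def by (simp only: powr_powr) simp
    finally show ?thesis using that by (simp add: powr_minus_divide)
  qed
  have g1: "g u > 1" if "u \<in> ?S" for u
  proof -
    have "1 < (g u)\<^sup>2" using that by (simp add: gsq)
    moreover have "g u > 0" using that by (simp add: g_def)
    ultimately show ?thesis by (smt (verit) power2_eq_square mult_le_one)
  qed
  have img: "g ` ?S = {1<..}"
  proof (intro equalityI subsetI)
    fix \<rho> :: real assume "\<rho> \<in> {1<..}"
    then have \<rho>: "\<rho> > 1" by simp
    then have r2: "\<rho>\<^sup>2 > 1" by (simp add: one_less_power)
    have "g (1 - 1 / \<rho>\<^sup>2) = \<rho>"
    proof (rule power2_eq_imp_eq)
      show "(g (1 - 1 / \<rho>\<^sup>2))\<^sup>2 = \<rho>\<^sup>2" using \<rho> by (subst gsq) auto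
    qed (use \<rho> in \<open>auto simp: g_def\<close>)
    moreover have "1 - 1 / \<rho>\<^sup>2 \<in> ?S"
    proof -
      have "1 / \<rho>\<^sup>2 < 1" using r2 by (subst divide_less_eq_1_pos) auto
      then show ?thesis using \<rho> by simp
    qed
    ultimately show "\<rho> \<in> g ` ?S" by (metis image_eqI)
  qed (use g1 in auto)
  have inj: "inj_on g ?S"
  proof (rule inj_onI)
    fix u v assume "u \<in> ?S" "v \<in> ?S" "g u = g v"
    then have "1 / (1 - u) = 1 / (1 - v)" using gsq by (metis greaterThanLessThan_iff)
    then show "u = v" by simp
  qed
  have der: "(g has_field_derivative g' u) (at u within ?S)" if "u \<in> ?S" for u
    using that unfolding g_def g'_def
    by (auto intro!: derivative_eq_intros)
  have fg: "\<bar>g' u\<bar> * f (g u) = u powr ((1 - s) - 1) * (1 - u) powr (s - 1) / 2" if "u \<in> ?S" for u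
  proof -
    have 1: "(g u)\<^sup>2 - 1 = u / (1 - u)" using that by (simp add: gsq field_simps)
    have 2: "g' u / g u = 1 / (2 * (1 - u))"
    proof -
      have "g' u / g u = (1 - u) powr (- 3 / 2 - - 1 / 2) / 2"
        by (simp only: g_def g'_def powr_diff) simp
      then show ?thesis using that by (simp add: powr_minus_divide)
    qed
    have "g' u > 0" using that by (simp add: g'_def)
    then have "\<bar>g' u\<bar> * f (g u) = (g' u / g u) * ((g u)\<^sup>2 - 1) powr (- s)"
      by (simp add: f_def)
    also have "\<dots> = (u / (1 - u)) powr (- s) / (2 * (1 - u))"
      unfolding 1 2 by simp
    also have "\<dots> = u powr ((1 - s) - 1) * (1 - u) powr (s - 1) / 2"
      using that by (simp add: powr_divide powr_diff powr_minus field_simps)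
    finally show ?thesis .
  qed
  have "Beta (1 - s) s = pi / sin (pi * s)"
    using Gamma_reflection_real[OF s] by (simp add: Beta_def mult.commute)
  then have "((\<lambda>u. u powr ((1 - s) - 1) * (1 - u) powr (s - 1)) has_integral pi / sin (pi * s)) ?S"
    using has_integral_Beta_real[of "1 - s" s] s by (simp add: has_integral_Icc_iff_Ioo)
  from has_integral_divide[OF this, of 2]
  have "((\<lambda>u. u powr ((1 - s) - 1) * (1 - u) powr (s - 1) / 2) has_integral pi / (2 * sin (pi * s))) ?S"
    by (simp add: mult.commute)
  then have hi: "((\<lambda>u. \<bar>g' u\<bar> * f (g u)) has_integral pi / (2 * sin (pi * s))) ?S"
    by (rule has_integral_eq[rotated]) (use fg in auto)
  \<comment> \<open>The change of variables asks for absolute integrability, which for a nonnegative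
    integrand follows from the integral just computed.\<close>
  then have "(\<lambda>u. \<bar>g' u\<bar> * f (g u)) absolutely_integrable_on ?S"
    by (intro nonnegative_absolutely_integrable_1) (auto simp: has_integral_integrable fg)
  with hi have "f absolutely_integrable_on g ` ?S \<and> integral (g ` ?S) f = pi / (2 * sin (pi * s))"
    using has_absolute_integral_change_of_variables_1'[OF _ der inj, of f "pi / (2 * sin (pi * s))"]
    by (auto simp: integral_unique)
  then have "(f has_integral pi / (2 * sin (pi * s))) {1<..}"
    unfolding img by (metis absolutely_integrable_on_def set_lebesgue_integral_eq_integral(1) has_integral_integrable_integral)
  from nn_integral_has_integral_lebesgue[OF _ this]
  have "(\<integral>\<^sup>+\<rho>. ennreal (indicator {1<..} \<rho> * f \<rho>) \<partial>lborel) = ennreal (pi / (2 * sin (pi * s)))"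
    by (auto simp: f_def)
  moreover have "ennreal (indicator {1<..} \<rho> * f \<rho>) =
      indicator {1<..} \<rho> * ennreal ((\<rho>\<^sup>2 - 1) powr (- s) / \<rho>)" for \<rho>
    by (simp add: f_def split: split_indicator)
  ultimately show ?thesis by simp
qed

section \<open>The number of steps\<close>

text \<open>Density of the jump rescaled to radius one, i.e. the kernel at the origin with
  \<open>r = 1\<close>. Every kernel from a point of the ball is an affine image of it.\<close>

definition wos_density :: "real \<Rightarrow> real^'n \<Rightarrow> real" where
  "wos_density s z = (if norm z > 1
     then alpha_ns CARD('n) s * ((norm z)\<^sup>2 - 1) powr (- s) / norm z ^ CARD('n) else 0)"

lemma borel_measurable_wos_density [measurable]: "wos_density s \<in> borel_measurable borel"
  unfolding wos_density_def[abs_def] by measurable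

lemma alpha_ns_pos: "0 < s \<Longrightarrow> s < 1 \<Longrightarrow> 0 < n \<Longrightarrow> alpha_ns n s > 0"
  unfolding alpha_ns_def by (auto intro!: divide_pos_pos mult_pos_pos sin_gt_zero)

text \<open>In polar coordinates \<open>\<rho> ^ (n - 1) / \<rho> ^ n\<close> leaves the
  \<open>1 / \<rho>\<close> of the radial integral, and \<open>alpha_ns\<close> is the reciprocal of
  the product of the sphere area \<open>n * V\<close> and
  \<open>pi / (2 * sin (pi * s))\<close>.\<close>

lemma nn_integral_wos_density:
  assumes s: "0 < s" "s < 1"
  shows "(\<integral>\<^sup>+z. ennreal (wos_density s (z::real^'n)) \<partial>lborel) = 1"
proof -
  define n where "n = CARD('n::finite)"
  have n: "n > 0" by (simp add: n_def)
  define f where "f = (\<lambda>\<rho>::real. if \<rho> > 1 then alpha_ns n s * (\<rho>\<^sup>2 - 1) powr (- s) / \<rho> ^ n else 0)"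
  define V where "V = unit_ball_vol (real n)"
  have sin: "sin (pi * s) > 0" using s by (intro sin_gt_zero) auto
  have V: "V \<ge> 0" by (simp add: V_def)
  have a: "alpha_ns n s \<ge> 0" using alpha_ns_pos[OF s n] by simp
  have "(\<integral>\<^sup>+z. ennreal (wos_density s (z::real^'n)) \<partial>lborel) = (\<integral>\<^sup>+z. ennreal (f (norm (z::real^'n))) \<partial>lborel)"
    unfolding f_def wos_density_def n_def ..
  also have "\<dots> = (\<integral>\<^sup>+\<rho>. ennreal (real n * V * \<rho> ^ (n - 1)) * indicator {0..} \<rho> * ennreal (f \<rho>) \<partial>lborel)"
    unfolding f_def by (subst nn_integral_lborel_norm) (simp_all add: n_def V_def)
  also have "\<dots> = (\<integral>\<^sup>+\<rho>. ennreal (real n * V * alpha_ns n s) * (indicator {1<..} \<rho> * ennreal ((\<rho>\<^sup>2 - 1) powr (- s) / \<rho>)) \<partial>lborel)"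
  proof (rule nn_integral_cong)
    fix \<rho> :: real
    show "ennreal (real n * V * \<rho> ^ (n - 1)) * indicator {0..} \<rho> * ennreal (f \<rho>) =
      ennreal (real n * V * alpha_ns n s) * (indicator {1<..} \<rho> * ennreal ((\<rho>\<^sup>2 - 1) powr (- s) / \<rho>))"
    proof (cases "\<rho> > 1")
      case True
      have "\<rho> ^ n = \<rho> * \<rho> ^ (n - 1)" using n by (metis power_minus_mult mult.commute)
      then have "(real n * V * \<rho> ^ (n - 1)) * f \<rho> = (real n * V * alpha_ns n s) * ((\<rho>\<^sup>2 - 1) powr (- s) / \<rho>)"
        using True by (simp add: f_def)
      then show ?thesis using True V a
        by (simp add: ennreal_mult'[symmetric])
    qed (simp add: f_def)
  qed
  also have "\<dots> = ennreal (real n * V * alpha_ns n s) * ennreal (pi / (2 * sin (pi * s)))"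
    by (subst nn_integral_cmult, measurable, subst nn_integral_wos_radial[OF s]) simp
  also have "\<dots> = ennreal (real n * V * alpha_ns n s * (pi / (2 * sin (pi * s))))"
    using V a by (simp add: ennreal_mult'[symmetric])
  also have "real n * V * alpha_ns n s * (pi / (2 * sin (pi * s))) = 1"
  proof -
    have "Gamma (real n / 2 + 1) = real n / 2 * Gamma (real n / 2)"
      using n by (intro Gamma_plus1) (auto elim!: nonpos_Ints_cases simp: field_simps)
    moreover have "pi powr (real n / 2 + 1) = pi powr (real n / 2) * pi" by (simp add: powr_add)
    moreover have "real n * (P / (real n / 2 * G)) * (G * S / (P * pi)) * (pi / (2 * S)) = 1"
      if "P > 0" "G > 0" "S > 0" for P G S :: real
      using that n by (simp add: field_simps)
    moreover have "Gamma (real n / 2) > 0" using n by simp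
    ultimately show ?thesis using n sin
      unfolding V_def unit_ball_vol_def alpha_ns_def by (simp del: Gamma_real_pos)
  qed
  finally show ?thesis by simp
qed

text \<open>The Jacobian of the affine map cancels the scaling of the kernel density. The position
  \<open>X\<close> then enters only through the map, which serves both measurability in
  \<open>X\<close> and an exit estimate uniform in \<open>X\<close>.\<close>

lemma wos_kernel_eq_distr:
  fixes X :: "real^'n"
  assumes X: "X \<in> ball 0 r"
  shows "wos_kernel s r X =
    distr (density lborel (\<lambda>z. ennreal (wos_density s z))) borel (\<lambda>z. X + (r - norm X) *\<^sub>R z)"
    (is "_ = ?D")
proof (rule measure_eqI)
  show "sets (wos_kernel s r X) = sets ?D" by (simp add: wos_kernel_def Let_def)
  fix A assume "A \<in> sets (wos_kernel s r X)"
  then have [measurable]: "A \<in> sets borel" by (simp add: wos_kernel_def Let_def)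
  define \<rho> where "\<rho> = r - norm X"
  have \<rho>: "\<rho> > 0" using X by (simp add: \<rho>_def)
  define k where "k = (\<lambda>x. if dist x X > \<rho> then
      alpha_ns CARD('n) s * (\<rho>\<^sup>2 / ((dist x X)\<^sup>2 - \<rho>\<^sup>2)) powr s / (dist x X) ^ CARD('n) else 0)"
  have [measurable]: "k \<in> borel_measurable borel" unfolding k_def by measurable
  have k: "\<rho> ^ CARD('n) * k (X + \<rho> *\<^sub>R z) = wos_density s z" for z
  proof -
    have d: "dist (X + \<rho> *\<^sub>R z) X = \<rho> * norm z" using \<rho> by (simp add: dist_norm)
    have "\<rho>\<^sup>2 / ((\<rho> * norm z)\<^sup>2 - \<rho>\<^sup>2) = 1 / ((norm z)\<^sup>2 - 1)"
    proof -
      have "(\<rho> * norm z)\<^sup>2 - \<rho>\<^sup>2 = \<rho>\<^sup>2 * ((norm z)\<^sup>2 - 1)"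
        by (simp add: power_mult_distrib algebra_simps)
      then show ?thesis using \<rho> by simp
    qed
    then show ?thesis using \<rho>
      by (auto simp: k_def d wos_density_def powr_minus_divide powr_divide power_mult_distrib)
  qed
  have "wos_kernel s r X = density lborel (\<lambda>x. ennreal (k x))"
    unfolding wos_kernel_def Let_def k_def \<rho>_def ..
  then have "emeasure (wos_kernel s r X) A = (\<integral>\<^sup>+x. ennreal (k x) * indicator A x \<partial>lborel)"
    by (simp add: emeasure_density)
  also have "\<dots> = ennreal (\<rho> ^ CARD('n)) * (\<integral>\<^sup>+z. ennreal (k (X + \<rho> *\<^sub>R z)) * indicator A (X + \<rho> *\<^sub>R z) \<partial>lborel)"
    using \<rho> by (subst nn_integral_lborel_affine[of _ \<rho> X]) auto
  also have "\<dots> = (\<integral>\<^sup>+z. ennreal (wos_density s z) * indicator A (X + \<rho> *\<^sub>R z) \<partial>lborel)"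
    using \<rho> by (subst nn_integral_cmult[symmetric]) (auto simp: mult.assoc[symmetric] ennreal_mult'[symmetric] k)
  also have "\<dots> = emeasure ?D A"
  proof -
    have [measurable]: "(\<lambda>z. X + \<rho> *\<^sub>R z) -` A \<in> sets borel"
      by (rule measurable_sets_borel[of _ borel]) measurable
    have "emeasure ?D A = (\<integral>\<^sup>+z. ennreal (wos_density s z) * indicator ((\<lambda>z. X + \<rho> *\<^sub>R z) -` A) z \<partial>lborel)"
      by (subst emeasure_distr) (auto simp: emeasure_density \<rho>_def[symmetric])
    then show ?thesis by (simp add: indicator_def)
  qed
  finally show "emeasure (wos_kernel s r X) A = emeasure ?D A" .
qed

lemma prob_space_wos_density:
  assumes "0 < s" "s < 1"
  shows "prob_space (density lborel (\<lambda>z::real^'n. ennreal (wos_density s z)))"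
  by (rule prob_spaceI) (use assms in \<open>simp add: emeasure_density nn_integral_wos_density\<close>)

text \<open>Inside the ball the step is the image of one fixed probability measure under a map
  jointly measurable in \<open>X\<close> and \<open>z\<close>. Measurability as a kernel is what the
  \<open>bind\<close> in \<open>wos_law\<close> rests on.\<close>

lemma measurable_wos_step:
  assumes s: "0 < s" "s < 1"
  shows "wos_step s r \<in> borel \<rightarrow>\<^sub>M subprob_algebra (borel :: (real^'n) measure)"
proof -
  let ?P = "density lborel (\<lambda>z::real^'n. ennreal (wos_density s z))"
  interpret P: prob_space ?P by (rule prob_space_wos_density[OF s])
  have P: "?P \<in> space (subprob_algebra borel)"
    by (auto simp: space_subprob_algebra intro: P.subprob_space_axioms)
  \<comment> \<open>\<open>return\<close> depends on its measure only through the sigma-algebra, so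
    \<open>return lborel X\<close> and \<open>return borel X\<close> are equal.\<close>
  have "wos_step s r = (\<lambda>X::real^'n. if X \<in> ball 0 r
      then distr ?P borel (\<lambda>z. X + (r - norm X) *\<^sub>R z) else return borel X)"
    by (auto simp: wos_step_def fun_eq_iff wos_kernel_eq_distr return_def)
  also have "\<dots> \<in> borel \<rightarrow>\<^sub>M subprob_algebra borel"
  proof (rule measurable_If)
    show "(\<lambda>X. distr ?P borel (\<lambda>z. X + (r - norm X) *\<^sub>R z)) \<in> borel \<rightarrow>\<^sub>M subprob_algebra borel"
      by (rule measurable_distr2[where M = borel]) (use P in \<open>simp_all\<close>)
  qed auto
  finally show ?thesis .
qed

text \<open>A lower bound for the probability that the unit jump enters a halfspace at distance 1.\<close>

definition halfspace_exit :: "nat \<Rightarrow> real \<Rightarrow> real" where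
  "halfspace_exit n s = sin (pi * s) * Gamma (s + 1/2) * Gamma (real n / 2) /
     (2 * s * pi * sqrt pi * Gamma (real n / 2 + s))"

lemma halfspace_exit_pos: "0 < s \<Longrightarrow> s < 1 \<Longrightarrow> n > 0 \<Longrightarrow> halfspace_exit n s > 0"
  unfolding halfspace_exit_def
  by (intro divide_pos_pos mult_pos_pos sin_gt_zero Gamma_real_pos add_pos_pos) auto

text \<open>Replacing \<open>|z|\<^sup>2 - 1\<close> by \<open>|z|\<^sup>2\<close> only decreases the density and makes the halfspace integral explicit.\<close>

lemma wos_density_halfspace_ge:
  fixes e :: "real^'n"
  assumes s: "0 < s" "s < 1" and e: "norm e = 1"
  shows "ennreal (halfspace_exit CARD('n) s) \<le>
    (\<integral>\<^sup>+z. indicator {1..} (z \<bullet> e) * ennreal (wos_density s z) \<partial>lborel)"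
proof -
  define n where "n = CARD('n)"
  have n: "n > 0" by (simp add: n_def)
  define a where "a = alpha_ns n s"
  have a: "a > 0" unfolding a_def by (rule alpha_ns_pos[OF s n])
  have "ennreal (halfspace_exit n s) =
      ennreal a * ennreal (pi powr ((real n - 1) / 2) * Gamma (s + 1/2) / (2 * s * Gamma (real n / 2 + s)))"
  proof -
    have "pi powr ((real n - 1) / 2) / pi powr (real n / 2 + 1) = pi powr (- 1 - 1 / 2)"
      by (simp add: powr_diff[symmetric] diff_divide_distrib)
    also have "\<dots> = 1 / (pi * sqrt pi)"
      by (simp only: powr_diff) (simp add: powr_minus_divide powr_half_sqrt)
    finally have "pi powr ((real n - 1) / 2) / pi powr (real n / 2 + 1) = 1 / (pi * sqrt pi)" .
    then have "halfspace_exit n s = a * (pi powr ((real n - 1) / 2) * Gamma (s + 1/2) / (2 * s * Gamma (real n / 2 + s)))"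
      by (simp add: halfspace_exit_def a_def alpha_ns_def field_simps)
    then show ?thesis using a by (simp add: ennreal_mult'[symmetric])
  qed
  also have "\<dots> = (\<integral>\<^sup>+z. ennreal a * (indicator {1..} (z \<bullet> e) * ennreal (norm z powr - (real n + 2 * s))) \<partial>lborel)"
    using nn_integral_powr_halfspace[OF s(1) e] by (subst nn_integral_cmult) (auto simp: n_def)
  also have "\<dots> \<le> (\<integral>\<^sup>+z. indicator {1..} (z \<bullet> e) * ennreal (wos_density s z) \<partial>lborel)"
  proof (rule nn_integral_mono_AE)
    \<comment> \<open>On the unit sphere \<open>wos_density\<close> is 0 while the lower bound is
      positive at \<open>e\<close>, so the sphere is removed as a null set.\<close>
    have "AE z in lborel. z \<notin> sphere (0::real^'n) 1"
      using negligible_sphere[of "0::real^'n" 1]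
      by (intro AE_not_in) (simp add: negligible_iff_null_sets null_sets_completion_iff)
    then show "AE z in lborel. ennreal a * (indicator {1..} (z \<bullet> e) * ennreal (norm z powr - (real n + 2 * s)))
        \<le> indicator {1..} (z \<bullet> e) * ennreal (wos_density s z)"
    proof eventually_elim
      case (elim z)
      show ?case
      proof (cases "z \<bullet> e \<ge> 1")
        case True
        then have "norm z \<ge> 1" using norm_cauchy_schwarz[of z e] e by simp
        then have z: "norm z > 1" using elim by (auto simp: dist_norm)
        then have z2: "(norm z)\<^sup>2 > 1" by (simp add: one_less_power)
        have "norm z powr - (real n + 2 * s) = ((norm z)\<^sup>2) powr (- s) / norm z ^ n"
        proof -
          have "norm z powr - (real n + 2 * s) = norm z powr (2 * - s) / norm z powr (real n)"
          proof -
            have "- (real n + 2 * s) = 2 * - s - real n" by simp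
            then show ?thesis by (simp only: powr_diff)
          qed
          also have "norm z powr (2 * - s) = (norm z powr 2) powr (- s)" by (rule powr_powr[symmetric])
          also have "norm z powr 2 = (norm z)\<^sup>2" by simp
          also have "norm z powr (real n) = norm z ^ n" using z by (intro powr_realpow) linarith
          finally show ?thesis .
        qed
        also have "\<dots> \<le> ((norm z)\<^sup>2 - 1) powr (- s) / norm z ^ n"
          using s z z2 by (intro divide_right_mono powr_mono2') auto
        finally have "a * norm z powr - (real n + 2 * s) \<le> a * (((norm z)\<^sup>2 - 1) powr (- s) / norm z ^ n)"
          using a by (intro mult_left_mono) auto
        also have "\<dots> = wos_density s z"
          using z by (simp add: wos_density_def a_def n_def)
        finally have "a * norm z powr - (real n + 2 * s) \<le> wos_density s z" .
        then show ?thesis using True a by (simp add: ennreal_mult'[symmetric] ennreal_leI)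
      qed simp
    qed
  qed
  finally show ?thesis by (simp add: n_def)
qed

text \<open>It is a lower bound for a probability. This makes \<open>1 - halfspace_exit\<close>
  nonnegative, hence usable as the ratio of a geometric series.\<close>

lemma halfspace_exit_le_1:
  assumes s: "0 < s" "s < 1"
  shows "halfspace_exit CARD('n::finite) s \<le> 1"
proof -
  obtain e :: "real^'n" where "e \<in> Basis" using nonempty_Basis by blast
  then have "ennreal (halfspace_exit CARD('n) s) \<le>
      (\<integral>\<^sup>+z. indicator {1..} (z \<bullet> e) * ennreal (wos_density s z) \<partial>lborel)"
    by (intro wos_density_halfspace_ge s) simp
  also have "\<dots> \<le> (\<integral>\<^sup>+z. ennreal (wos_density s (z::real^'n)) \<partial>lborel)"
    by (intro nn_integral_mono) (simp split: split_indicator)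
  finally show ?thesis by (simp add: nn_integral_wos_density[OF s])
qed

text \<open>If the unit jump satisfies \<open>z \<bullet> e \<ge> 1\<close>, with \<open>e\<close>
  the direction of \<open>X\<close>, the new position has component at least
  \<open>norm X + (r - norm X) = r\<close> along \<open>e\<close>, so it lies outside the ball. The
  indicator on the right records that the stopped chain never returns.\<close>

lemma wos_step_ball_le:
  fixes X :: "real^'n"
  assumes s: "0 < s" "s < 1"
  shows "emeasure (wos_step s r X) (ball 0 r) \<le> ennreal (1 - halfspace_exit CARD('n) s) * indicator (ball 0 r) X"
proof (cases "X \<in> ball 0 r")
  case False
  then show ?thesis by (simp add: wos_step_def)
next
  case True
  define \<rho> where "\<rho> = r - norm X"
  have \<rho>: "\<rho> > 0" using True by (simp add: \<rho>_def)
  let ?P = "density lborel (\<lambda>z::real^'n. ennreal (wos_density s z))"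
  interpret P: prob_space ?P by (rule prob_space_wos_density[OF s])
  \<comment> \<open>At the centre any unit vector can play the role of the direction of
    \<open>X\<close>.\<close>
  obtain e :: "real^'n" where e: "norm e = 1" "X = norm X *\<^sub>R e"
  proof (cases "X = 0")
    case True
    obtain b :: "real^'n" where "b \<in> Basis" using nonempty_Basis by blast
    then show ?thesis using that[of b] True by simp
  next
    case False
    then show ?thesis using that[of "X /\<^sub>R norm X"] by simp
  qed
  let ?H = "{z::real^'n. z \<bullet> e \<ge> 1}"
  have [measurable]: "?H \<in> sets borel" by measurable
  have "{z. X + \<rho> *\<^sub>R z \<in> ball 0 r} \<subseteq> space ?P - ?H"
  proof
    fix z assume z: "z \<in> {z. X + \<rho> *\<^sub>R z \<in> ball 0 r}"
    have "(X + \<rho> *\<^sub>R z) \<bullet> e = norm X * (e \<bullet> e) + \<rho> * (z \<bullet> e)"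
      by (subst e(2)) (simp add: inner_add_left)
    also have "e \<bullet> e = 1" using e(1) by (simp add: norm_eq_1)
    finally have "norm X + \<rho> * (z \<bullet> e) \<le> norm (X + \<rho> *\<^sub>R z)"
      using norm_cauchy_schwarz[of "X + \<rho> *\<^sub>R z" e] e(1) by simp
    also have "\<dots> < r" using z by simp
    finally have "\<rho> * (z \<bullet> e) < \<rho> * 1" by (simp add: \<rho>_def)
    then have "z \<bullet> e < 1" using \<rho> by simp
    then show "z \<in> space ?P - ?H" by simp
  qed
  then have "emeasure (wos_step s r X) (ball 0 r) \<le> emeasure ?P (space ?P - ?H)"
    using True by (simp add: wos_step_def wos_kernel_eq_distr emeasure_distr vimage_def flip: \<rho>_def)
      (rule emeasure_mono, auto)
  also have "\<dots> = 1 - emeasure ?P ?H"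
    using P.emeasure_space_1 by (subst emeasure_compl) auto
  also have "\<dots> \<le> 1 - ennreal (halfspace_exit CARD('n) s)"
  proof (rule ennreal_minus_mono[OF order_refl])
    have "emeasure ?P ?H = (\<integral>\<^sup>+z. indicator {1..} (z \<bullet> e) * ennreal (wos_density s z) \<partial>lborel)"
      by (subst emeasure_density) (auto intro!: nn_integral_cong split: split_indicator)
    then show "ennreal (halfspace_exit CARD('n) s) \<le> emeasure ?P ?H"
      using wos_density_halfspace_ge[OF s e(1)] by simp
  qed
  also have "\<dots> = ennreal (1 - halfspace_exit CARD('n) s)"
    using halfspace_exit_pos[OF s, of "CARD('n)"] by (simp add: ennreal_minus flip: ennreal_1)
  finally show ?thesis using True by simp
qed

section \<open>Geometric decay of the survival probability\<close>

lemma wos_law_space: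
  assumes s: "0 < s" "s < 1"
  shows "wos_law s r x0 k \<in> space (subprob_algebra (borel :: (real^'n) measure))"
proof (induction k)
  case 0
  have "return lborel x0 = return borel x0" by (simp add: return_def)
  then show ?case
    using prob_space_return[of x0 borel]
    by (auto simp: space_subprob_algebra intro: prob_space_imp_subprob_space)
next
  case (Suc k)
  have sets: "sets (wos_law s r x0 k) = sets borel" and sub: "subprob_space (wos_law s r x0 k)"
    using Suc by (auto simp: space_subprob_algebra)
  have f: "wos_step s r \<in> wos_law s r x0 k \<rightarrow>\<^sub>M subprob_algebra borel"
    using measurable_wos_step[OF s, of r] by (simp only: measurable_cong_sets[OF sets refl])
  have "space (wos_law s r x0 k) \<noteq> {}"
    using sets_eq_imp_space_eq[OF sets] by simp
  then show ?case
    using subprob_space_bind[OF sub f] sets_bind_measurable[OF f] by (simp add: space_subprob_algebra)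
qed

text \<open>By induction: the indicator in the one-step bound turns the integral against the law at
  time \<open>k\<close> into the mass that this law still has in the ball.\<close>

lemma wos_law_ball_le:
  fixes x0 :: "real^'n"
  assumes s: "0 < s" "s < 1"
  shows "emeasure (wos_law s r x0 k) (ball 0 r) \<le> ennreal (1 - halfspace_exit CARD('n) s) ^ k"
proof (induction k)
  case 0
  show ?case by (simp add: indicator_def)
next
  case (Suc k)
  have sets: "sets (wos_law s r x0 k) = sets borel"
    using wos_law_space[OF s, of r x0 k] by (simp add: space_subprob_algebra)
  have "emeasure (wos_law s r x0 (Suc k)) (ball 0 r) = (\<integral>\<^sup>+X. emeasure (wos_step s r X) (ball 0 r) \<partial>wos_law s r x0 k)"
  proof -
    have "wos_step s r \<in> wos_law s r x0 k \<rightarrow>\<^sub>M subprob_algebra borel"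
      using measurable_wos_step[OF s, of r] by (simp only: measurable_cong_sets[OF sets refl])
    moreover have "space (wos_law s r x0 k) \<noteq> {}"
      using sets_eq_imp_space_eq[OF sets] by simp
    ultimately show ?thesis by (simp add: emeasure_bind)
  qed
  also have "\<dots> \<le> (\<integral>\<^sup>+X. ennreal (1 - halfspace_exit CARD('n) s) * indicator (ball 0 r) X \<partial>wos_law s r x0 k)"
    by (intro nn_integral_mono wos_step_ball_le s)
  also have "\<dots> = ennreal (1 - halfspace_exit CARD('n) s) * emeasure (wos_law s r x0 k) (ball 0 r)"
    by (rule nn_integral_cmult_indicator) (simp add: sets)
  also have "\<dots> \<le> ennreal (1 - halfspace_exit CARD('n) s) ^ Suc k"
    using Suc by (simp add: mult_left_mono)
  finally show ?case .
qed

lemma wos_expected_steps_le: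
  fixes x0 :: "real^'n"
  assumes s: "0 < s" "s < 1"
  shows "wos_expected_steps s r x0 \<le> ennreal (1 / halfspace_exit CARD('n) s)"
proof -
  define p where "p = halfspace_exit CARD('n) s"
  have p: "p > 0" unfolding p_def using s by (intro halfspace_exit_pos) auto
  have p1: "p \<le> 1" unfolding p_def using s by (rule halfspace_exit_le_1)
  have "wos_expected_steps s r x0 \<le> (\<Sum>k. ennreal (1 - p) ^ k)"
    unfolding wos_expected_steps_def p_def by (intro suminf_le wos_law_ball_le s summableI)
  also have "\<dots> = (\<Sum>k. ennreal ((1 - p) ^ k))"
    using p1 by (simp add: ennreal_power)
  also have "\<dots> = ennreal (1 / (1 - (1 - p)))"
    using p p1 by (intro suminf_ennreal_eq geometric_sums) auto
  finally show ?thesis by (simp add: p_def)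
qed

section \<open>Monotonicity of the bound\<close>

text \<open>The logarithm of Gamma is convex and vanishes at 1 and 2.\<close>

lemma Gamma_le_one:
  fixes x :: real
  assumes "1 \<le> x" "x \<le> 2"
  shows "Gamma x \<le> 1"
proof -
  have "(ln \<circ> Gamma) ((1 - (x - 1)) *\<^sub>R 1 + (x - 1) *\<^sub>R 2) \<le>
      (1 - (x - 1)) * (ln \<circ> Gamma) 1 + (x - 1) * (ln \<circ> Gamma) (2::real)"
    using assms by (intro convex_onD[OF log_convex_Gamma_real]) auto
  then have "ln (Gamma x) \<le> 0" by (simp add: Gamma_numeral)
  then show ?thesis using assms Gamma_real_pos[of x] by simp
qed

text \<open>Log-convexity in increment form: for fixed \<open>h\<close> the increment
  \<open>ln_Gamma (u + h) - ln_Gamma u\<close> increases with \<open>u\<close>, because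
  \<open>Digamma\<close> does.\<close>

lemma Gamma_mult_le:
  fixes x y h :: real
  assumes "0 < x" "x \<le> y" "0 \<le> h"
  shows "Gamma y * Gamma (x + h) \<le> Gamma (y + h) * Gamma x"
proof -
  have "ln_Gamma (x + h) - ln_Gamma x \<le> ln_Gamma (y + h) - ln_Gamma y"
  proof (rule DERIV_nonneg_imp_nondecreasing[OF assms(2)])
    fix u assume "x \<le> u" "u \<le> y"
    then have u: "u > 0" using assms by simp
    have "((\<lambda>u. ln_Gamma (u + h) - ln_Gamma u) has_real_derivative Digamma (u + h) - Digamma u) (at u)"
      using u assms by (auto intro!: derivative_eq_intros)
    moreover have "Digamma u \<le> Digamma (u + h)" using u assms by (intro Digamma_real_mono) auto
    ultimately show "\<exists>D. ((\<lambda>u. ln_Gamma (u + h) - ln_Gamma u) has_real_derivative D) (at u) \<and> 0 \<le> D"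
      by (intro exI[of _ "Digamma (u + h) - Digamma u"]) auto
  qed
  then have "exp (ln_Gamma y + ln_Gamma (x + h)) \<le> exp (ln_Gamma (y + h) + ln_Gamma x)" by simp
  then show ?thesis using assms by (simp add: exp_add Gamma_real_pos_exp)
qed

lemma Beta_mono_left:
  fixes a b c :: real
  assumes "0 < a" "a \<le> b" "0 < c"
  shows "Beta b c \<le> Beta a c"
  using Gamma_mult_le[of a b c] assms
  by (simp add: Beta_def divide_le_eq pos_le_divide_eq mult.commute mult.left_commute mult_left_mono)

text \<open>Together with \<open>Beta_mono_left\<close> this gives
  \<open>real n * Beta a (real n) \<ge> 1\<close> for \<open>0 < a \<le> 1\<close>, so powers with
  this base increase with the exponent.\<close>

lemma Beta_one_left:
  assumes "0 < (c::real)"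
  shows "Beta 1 c = 1 / c"
proof -
  have "Gamma (1 + c) = c * Gamma c"
    using assms by (subst add.commute, intro Gamma_plus1) (auto elim!: nonpos_Ints_cases)
  moreover have "Gamma c \<noteq> 0" using Gamma_real_pos[OF assms] by linarith
  ultimately show ?thesis using assms by (simp add: Beta_def)
qed

text \<open>The part of the common prefactor of the bound that is increasing by log-convexity of Gamma.\<close>

definition wos_K :: "nat \<Rightarrow> real \<Rightarrow> real" where
  "wos_K n s = Gamma (real n / 2 + s) / Gamma (real n / 2) *
     max (2 powr (2 * s) / Gamma (1 + s)) (Gamma (real n / 2 - s) / Gamma (real n / 2))"

lemma wos_K_pos: "2 \<le> n \<Longrightarrow> 0 < s \<Longrightarrow> s < 1 \<Longrightarrow> wos_K n s > 0"
  unfolding wos_K_def by (intro mult_pos_pos divide_pos_pos Gamma_real_pos) (auto simp: less_max_iff_disj)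

text \<open>Each entry of the maximum increases once it is multiplied by
  \<open>Gamma (a + s)\<close>, where \<open>a = n / 2\<close>. For the first entry this uses
  \<open>a \<ge> 1\<close>, so that \<open>Gamma (a + s)\<close> grows at least as fast in ratio as
  \<open>Gamma (1 + s)\<close>.\<close>

lemma wos_K_mono:
  assumes n: "2 \<le> n" and s: "0 < s" "s \<le> t" "t < 1"
  shows "wos_K n s \<le> wos_K n t"
proof -
  define a where "a = real n / 2"
  have a: "a \<ge> 1" using n by (simp add: a_def)
  have pos: "Gamma a > 0" "Gamma (1 + s) > 0" "Gamma (1 + t) > 0" "Gamma (a + s) > 0" "Gamma (a + t) > 0"
    using a s by auto
  have K: "wos_K n u = max (2 powr (2 * u) * (Gamma (a + u) / Gamma (1 + u)) / Gamma a)
      (Gamma (a + u) * Gamma (a - u) / (Gamma a)\<^sup>2)" if "0 < u" for u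
  proof -
    have "Gamma (a + u) / Gamma a \<ge> 0" using a that by simp
    then show ?thesis
      unfolding wos_K_def a_def[symmetric]
      by (subst max_mult_distrib_left) (simp add: power2_eq_square field_simps)
  qed
  have "Gamma (a + s) / Gamma (1 + s) \<le> Gamma (a + t) / Gamma (1 + t)"
    using Gamma_mult_le[of "1 + s" "a + s" "t - s"] a s pos
    by (simp add: divide_le_eq pos_le_divide_eq mult.commute)
  moreover have "2 powr (2 * s) \<le> (2::real) powr (2 * t)" using s by simp
  ultimately have 1: "2 powr (2 * s) * (Gamma (a + s) / Gamma (1 + s)) / Gamma a
      \<le> 2 powr (2 * t) * (Gamma (a + t) / Gamma (1 + t)) / Gamma a"
    using pos by (intro divide_right_mono mult_mono) auto
  \<comment> \<open>Shifting \<open>a - t\<close> and \<open>a + s\<close> by \<open>t - s\<close>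
    gives \<open>a - s\<close> and \<open>a + t\<close>: of two pairs centred at \<open>a\<close>,
    the wider one has the larger product.\<close>
  have 2: "Gamma (a + s) * Gamma (a - s) / (Gamma a)\<^sup>2 \<le> Gamma (a + t) * Gamma (a - t) / (Gamma a)\<^sup>2"
    using Gamma_mult_le[of "a - t" "a + s" "t - s"] a s by (intro divide_right_mono) auto
  have "0 < t" using s by simp
  then show ?thesis unfolding K[OF s(1)] K[OF \<open>0 < t\<close>] by (intro max.mono 1 2)
qed

text \<open>\<open>Gamma (s + 1)\<close> over the \<open>Gamma s\<close> inside \<open>C4\<close>
  leaves a factor \<open>s\<close>, the powers of \<open>pi\<close> cancel, and
  \<open>Gamma (n / 2)\<close> is factored out of the maximum. The factor \<open>s\<close> later
  offsets the \<open>1 / s1\<close> of the first summand.\<close>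

lemma wos_prefactor_eq:
  assumes n: "2 \<le> n" and s: "0 < s" "s < 1"
  shows "2 powr (4 * s + 1) * pi powr (real n / 2) * Gamma (s + real n / 2) * Gamma (s + 1)
       / (Gamma (real n / 2))\<^sup>2 * C4 n s = 2 * s * 2 powr (4 * s) * wos_K n s"
proof -
  define a where "a = real n / 2"
  have a: "a \<ge> 1" using n by (simp add: a_def)
  have pos: "Gamma a > 0" using a by simp
  have ne: "Gamma s \<noteq> 0" "Gamma a \<noteq> 0" using Gamma_real_pos[OF s(1)] pos by linarith+
  have G: "Gamma (s + 1) = s * Gamma s"
    using s by (intro Gamma_plus1) (auto elim!: nonpos_Ints_cases)
  have max: "max (2 powr (2 * s) * Gamma a / Gamma (1 + s)) (Gamma (a - s)) =
      Gamma a * max (2 powr (2 * s) / Gamma (1 + s)) (Gamma (a - s) / Gamma a)"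
    using pos by (subst max_mult_distrib_left) (simp add: mult.commute)
  show ?thesis
    unfolding C4_def wos_K_def a_def[symmetric] max G
    using ne s by (simp add: powr_add powr_minus field_simps power2_eq_square)
qed

text \<open>This is \<open>- gamma_of n s\<close> for \<open>s1 = s1_of s\<close>, which is positive, so that powers can be handled through logarithms.\<close>

definition wos_gap :: "real \<Rightarrow> nat \<Rightarrow> real \<Rightarrow> real" where
  "wos_gap s1 n s = (1 + s1 + s) * (real n - s1) / (1 - s1 - s) - real n"

text \<open>The logarithm of \<open>s 2\<^sup>4\<^sup>s\<close> (from the prefactor) times the second summand of the bound, after
  splitting off \<open>(n B)\<^sup>\<theta>\<close>.\<close>

definition wos_log :: "real \<Rightarrow> nat \<Rightarrow> real \<Rightarrow> real \<Rightarrow> real \<Rightarrow> real" where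
  "wos_log s1 n s x \<Lambda> = (let q = 1 + s1 + s; \<theta> = 2 * (s1 + s) / q; g = wos_gap s1 n s in
     ln s + 5 * s * ln 2 - \<theta> * ln (real n) + (real n * \<theta> - (s1 + s)) * x +
     ((1 - s1 - s) / q) * (ln (1 - exp (- (g * \<Lambda>))) - ln g))"

text \<open>Clearing the denominator leaves \<open>s1 * (1 + s1 + s) < 2 * n * (s1 + s)\<close>,
  whose left side is below \<open>2 * s1\<close>.\<close>

lemma wos_gap_pos:
  assumes "2 \<le> n" "0 < s1" "0 < s" "s1 + s < 1"
  shows "wos_gap s1 n s > 0"
proof -
  have "real n * (1 - s1 - s) < (1 + s1 + s) * (real n - s1)"
  proof -
    have "s1 * (1 + (s1 + s)) < s1 * 2"
      using assms by (intro mult_strict_left_mono) auto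
    moreover have "2 * (s1 + s) \<le> real n * (s1 + s)"
      using assms by (intro mult_right_mono) auto
    moreover have "s1 * 2 \<le> 2 * (2 * (s1 + s))" using assms by simp
    ultimately have "s1 * (1 + (s1 + s)) < 2 * (real n * (s1 + s))" by linarith
    then show ?thesis by (simp add: algebra_simps)
  qed
  then show ?thesis using assms by (simp add: wos_gap_def pos_less_divide_eq)
qed

text \<open>In units of \<open>d = (r - t) / 2\<close> one has
  \<open>r + t = d * exp \<Lambda>\<close>, so the bracket is \<open>d powr - g\<close> times
  \<open>J\<close>, the integral of \<open>exp (- g v)\<close> over
  \<open>0 < v < \<Lambda>\<close>. The total exponents of \<open>r\<close> and of
  \<open>1 / d\<close> are both \<open>n * \<theta> - (s1 + s)\<close>, so only scale-free ratios
  remain. The factor \<open>2 powr - (4 * s) / s\<close> undoes the part of the prefactor included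
  in \<open>wos_log\<close>.\<close>

lemma wos_second_term_eq:
  fixes r t s s1 :: real
  assumes n: "2 \<le> n" and s: "0 < s1" "0 < s" "s1 + s < 1" and t: "0 \<le> t" "t < r"
  defines "q \<equiv> 1 + s1 + s"
  defines "g \<equiv> wos_gap s1 n s" and "\<theta> \<equiv> 2 * (s1 + s) / q"
  shows "(r - t) powr s * (r powr (real n - q / 2) * Beta (1 - q / 2) (real n)) powr \<theta> *
        ((1 / - g) * ((r + t) powr - g - ((r - t) / 2) powr - g)) powr ((1 - s1 - s) / q) =
     (real n * Beta (1 - q / 2) (real n)) powr \<theta> * 2 powr - (4 * s) / s *
       exp (wos_log s1 n s (ln (2 * r / (r - t))) (ln (2 * (r + t) / (r - t))))"
proof -
  define d where "d = (r - t) / 2"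
  define B where "B = Beta (1 - q / 2) (real n)"
  define \<Lambda> where "\<Lambda> = ln (2 * (r + t) / (r - t))"
  define J where "J = (1 - exp (- (g * \<Lambda>))) / g"
  define p where "p = (1 - s1 - s) / q"
  have q: "1 < q" "q < 2" using s by (auto simp: q_def)
  have r: "r > 0" and d: "d > 0" using t by (auto simp: d_def)
  have B: "B > 0" using q n unfolding B_def Beta_def by (intro divide_pos_pos mult_pos_pos Gamma_real_pos) auto
  have g: "g > 0" unfolding g_def using n s by (rule wos_gap_pos)
  have \<Lambda>: "\<Lambda> > 0" unfolding \<Lambda>_def using t by (intro ln_gt_zero) (auto simp: field_simps)
  then have e1: "1 - exp (- (g * \<Lambda>)) > 0" using g by simp
  then have J: "J > 0" using g by (simp add: J_def)
  have "exp \<Lambda> = 2 * (r + t) / (r - t)" unfolding \<Lambda>_def using t by (intro exp_ln) auto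
  moreover have "v = u / 2 * (2 * v / u)" if "u \<noteq> 0" for u v :: real using that by simp
  ultimately have rt: "r + t = d * exp \<Lambda>" using t by (simp only: d_def)
  have "(r + t) powr - g = d powr - g * exp (- (g * \<Lambda>))"
    using d by (simp add: rt powr_def ln_mult exp_add[symmetric] algebra_simps)
  then have D: "(1 / - g) * ((r + t) powr - g - ((r - t) / 2) powr - g) = d powr - g * J"
    using g by (simp add: d_def[symmetric] J_def field_simps)
  \<comment> \<open>Multiplication by \<open>p\<close> cancels the fraction in
    \<open>wos_gap\<close> and leaves \<open>n - s1 - n * p\<close>, where
    \<open>p = 1 - \<theta>\<close>.\<close>
  have pg: "p * g = real n * \<theta> - s1"
  proof -
    have "w / q * (q * m / w - k) = m - k * (w / q)" if "w \<noteq> 0" for w m k :: real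
      using that q by (simp add: field_simps)
    from this[of "1 - s1 - s"] have "p * g = (real n - s1) - real n * p"
      using s unfolding p_def g_def wos_gap_def q_def[symmetric] by simp
    moreover have "p = 1 - \<theta>" using q by (simp add: p_def \<theta>_def q_def field_simps)
    then have "real n * p = real n * (1 - \<theta>)" by simp
    then have "real n * p = real n - real n * \<theta>" by (simp only: right_diff_distrib)
    ultimately show ?thesis by linarith
  qed
  have \<theta>q: "\<theta> * (q / 2) = s1 + s" using q by (simp add: \<theta>_def)
  have lnd: "ln (r - t) = ln 2 + ln d" "ln (2 * r / (r - t)) = ln r - ln d"
    using d r by (auto simp: d_def ln_div ln_mult)
  have "(r - t) powr s * (r powr (real n - q / 2) * B) powr \<theta> * (d powr - g * J) powr p =
      exp (s * ln (r - t) + \<theta> * ((real n - q / 2) * ln r + ln B) + p * (- g * ln d + ln J))"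
    using r d B J t by (simp add: powr_def exp_add ln_mult)
  also have "s * ln (r - t) + \<theta> * ((real n - q / 2) * ln r + ln B) + p * (- g * ln d + ln J) =
      s * ln 2 + \<theta> * ln B + (real n * \<theta> - (s1 + s)) * (ln r - ln d) + p * ln J"
  proof -
    have "\<theta> * ((real n - q / 2) * ln r) = (real n * \<theta> - \<theta> * (q / 2)) * ln r" by (simp add: algebra_simps)
    moreover have "p * (- g * ln d) = - (p * g) * ln d" by simp
    ultimately show ?thesis unfolding \<theta>q pg lnd by (simp add: algebra_simps)
  qed
  also have "p * ln J = p * (ln (1 - exp (- (g * \<Lambda>))) - ln g)"
  proof -
    have "ln J = ln (1 - exp (- (g * \<Lambda>))) - ln g"
      unfolding J_def using ln_divide_pos[OF e1 g] .
    then show ?thesis by simp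
  qed
  also have "s * ln 2 + \<theta> * ln B + (real n * \<theta> - (s1 + s)) * (ln r - ln d) + p * (ln (1 - exp (- (g * \<Lambda>))) - ln g) =
      \<theta> * ln (real n * B) - 4 * s * ln 2 - ln s + wos_log s1 n s (ln (2 * r / (r - t))) \<Lambda>"
  proof -
    have "wos_log s1 n s X \<Lambda> = ln s + 5 * s * ln 2 - \<theta> * ln (real n) + (real n * \<theta> - (s1 + s)) * X +
        p * (ln (1 - exp (- (g * \<Lambda>))) - ln g)" for X
      unfolding wos_log_def Let_def q_def g_def \<theta>_def p_def ..
    note log = this[of "ln r - ln d"]
    have "ln (real n * B) = ln (real n) + ln B" using n B by (simp add: ln_mult)
    then show ?thesis unfolding lnd(2) log by (simp add: algebra_simps)
  qed
  also have "exp \<dots> = (real n * B) powr \<theta> * 2 powr - (4 * s) / s * exp (wos_log s1 n s (ln (2 * r / (r - t))) \<Lambda>)"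
    using n B s by (simp add: powr_def exp_add exp_diff exp_minus field_simps)
  finally show ?thesis
    unfolding D B_def[symmetric] p_def[symmetric] \<Lambda>_def[symmetric] .
qed

text \<open>The derivative of \<open>ln (1 - exp (- g \<Lambda>))\<close> is nonnegative and is dropped in the lower bound.\<close>

lemma has_derivative_truncated_exp:
  fixes g p :: "real \<Rightarrow> real"
  assumes g: "(g has_real_derivative g') (at s)" and p: "(p has_real_derivative p') (at s)"
    and pos: "g s > 0" "p s \<ge> 0" "g' \<ge> 0" "p' \<le> 0" "\<Lambda> > 0"
    and K: "ln (1 - exp (- (g s * \<Lambda>))) - ln (g s) \<le> K"
  obtains D where "((\<lambda>s. p s * (ln (1 - exp (- (g s * \<Lambda>))) - ln (g s))) has_real_derivative D) (at s)"
    and "D \<ge> p' * K - p s * g' / g s"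
proof
  define e where "e = exp (- (g s * \<Lambda>))"
  have e: "0 < e" "e < 1" using pos by (auto simp: e_def)
  let ?D = "p' * (ln (1 - e) - ln (g s)) + p s * (e * (g' * \<Lambda>) / (1 - e) - g' / g s)"
  show "((\<lambda>s. p s * (ln (1 - exp (- (g s * \<Lambda>))) - ln (g s))) has_real_derivative ?D) (at s)"
    using pos e unfolding e_def by (auto intro!: derivative_eq_intros g p simp: field_simps)
  have "p' * K \<le> p' * (ln (1 - e) - ln (g s))"
    using K pos by (intro mult_left_mono_neg) (auto simp: e_def)
  moreover have "0 \<le> p s * (e * (g' * \<Lambda>) / (1 - e))"
    using pos e by (intro mult_nonneg_nonneg divide_nonneg_nonneg) auto
  ultimately show "?D \<ge> p' * K - p s * g' / g s"
    by (simp add: algebra_simps)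
qed

text \<open>The tangent of \<open>ln\<close> at 1, taken at \<open>n / 2\<close>, and
  \<open>1/2 \<le> ln 2\<close>. The bound is linear in \<open>n - 2\<close> with slope
  \<open>ln 2\<close>, so that \<open>(n - 2) * x\<close> with \<open>x \<ge> ln 2\<close> absorbs
  it.\<close>

lemma ln_real_nat_le:
  assumes "2 \<le> n"
  shows "ln (real n) \<le> ln 2 + (real n - 2) * ln 2"
proof -
  have "ln (real n / 2) \<le> real n / 2 - 1" using assms by (intro ln_le_minus_one) auto
  also have "\<dots> \<le> (real n - 2) * ln 2"
  proof -
    have "(real n - 2) * (1 / 2) \<le> (real n - 2) * ln 2"
      using assms ln2_ge_two_thirds by (intro mult_left_mono) auto
    then show ?thesis by (simp add: field_simps)
  qed
  finally show ?thesis using assms by (simp add: ln_div)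
qed

text \<open>\<open>1 - exp (- v)\<close> is at most \<open>v\<close> and at most 1. The first bound
  stays finite as \<open>g\<close> tends to 0 and serves small \<open>s\<close>; the second serves
  \<open>s \<ge> 1/3\<close>, where \<open>g \<ge> 1\<close>.\<close>

lemma truncated_exp_ln_le:
  assumes "g > 0" "\<Lambda> > (0::real)"
  shows "ln (1 - exp (- (g * \<Lambda>))) - ln g \<le> ln \<Lambda>" and "ln (1 - exp (- (g * \<Lambda>))) - ln g \<le> - ln g"
proof -
  have pos: "1 - exp (- (g * \<Lambda>)) > 0" using assms by simp
  have "1 - exp (- (g * \<Lambda>)) \<le> g * \<Lambda>" using exp_ge_add_one_self[of "- (g * \<Lambda>)"] by simp
  then have "ln (1 - exp (- (g * \<Lambda>))) \<le> ln (g * \<Lambda>)" using pos assms by (simp add: ln_mono)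
  then show "ln (1 - exp (- (g * \<Lambda>))) - ln g \<le> ln \<Lambda>" using assms by (simp add: ln_mult)
  have "ln (1 - exp (- (g * \<Lambda>))) \<le> 0" using pos by simp
  then show "ln (1 - exp (- (g * \<Lambda>))) - ln g \<le> - ln g" by simp
qed

text \<open>The branch \<open>s1 = s\<close>. As \<open>s\<close> tends to 0, \<open>g\<close>
  vanishes linearly and the loss \<open>p * g' / g\<close> is of order \<open>1 / s\<close>; the
  derivative of \<open>ln s\<close> balances it.\<close>

lemma wos_log_mono_low:
  assumes n: "2 \<le> n" and s: "0 < a" "a \<le> b" "b \<le> 1/3"
    and x: "ln 2 \<le> x" and \<Lambda>: "0 < \<Lambda>" "\<Lambda> \<le> 2 * x - ln 2"
  shows "wos_log a n a x \<Lambda> \<le> wos_log b n b x \<Lambda>"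
proof -
  define g where "g = (\<lambda>s::real. s * (4 * real n - 1 - 2 * s) / (1 - 2 * s))"
  define p where "p = (\<lambda>s::real. (1 - 2 * s) / (1 + 2 * s))"
  define \<theta> where "\<theta> = (\<lambda>s::real. 4 * s / (1 + 2 * s))"
  define R where "R = (\<lambda>s. p s * (ln (1 - exp (- (g s * \<Lambda>))) - ln (g s)))"
  define L where "L = (\<lambda>s. ln s + 5 * s * ln 2 - \<theta> s * ln (real n) + (real n * \<theta> s - 2 * s) * x + R s)"
  have L: "wos_log s n s x \<Lambda> = L s" if "0 < s" "s \<le> 1/3" for s
  proof -
    have gap: "wos_gap s n s = g s" using that by (simp add: wos_gap_def g_def field_simps)
    have q: "1 + s + s = 1 + 2 * s" "s + s = 2 * s" "1 - s - s = 1 - 2 * s" "2 * (2 * s) = 4 * s" by auto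
    show ?thesis unfolding wos_log_def Let_def gap q L_def R_def p_def \<theta>_def ..
  qed
  \<comment> \<open>Tangent of \<open>ln\<close> at 4: its slope \<open>1/4\<close> turns
    \<open>2 * x\<close> into \<open>x / 2\<close>, small enough to be absorbed below, and the
    constants satisfy \<open>7/4 * ln 2 - 1 \<le> 1/4\<close>.\<close>
  have ln\<Lambda>: "ln \<Lambda> \<le> x / 2 + 1/4"
  proof -
    have "ln (\<Lambda> / 4) \<le> \<Lambda> / 4 - 1" using \<Lambda> by (intro ln_le_minus_one) auto
    moreover have "ln (4::real) = 2 * ln 2" using ln_realpow[of 2 2] by simp
    ultimately show ?thesis using \<Lambda> ln2_le_25_over_36 by (simp add: ln_div)
  qed
  have "L a \<le> L b"
  proof (rule DERIV_nonneg_imp_nondecreasing[OF s(2)])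
    fix s assume "a \<le> s" "s \<le> b"
    then have s: "0 < s" "s \<le> 1/3" using assms by auto
    define N where "N = 4 * real n - 1 - 2 * s"
    have N: "N > 0" using n s by (simp add: N_def)
    define g' where "g' = ((N - 2 * s) * (1 - 2 * s) + 2 * s * N) / (1 - 2 * s)\<^sup>2"
    define \<theta>' where "\<theta>' = 4 / (1 + 2 * s)\<^sup>2"
    have gpos: "g s > 0" using s N by (simp add: g_def N_def)
    have dg: "(g has_real_derivative g') (at s)"
      unfolding g_def g'_def N_def using s
      by (auto intro!: derivative_eq_intros simp: power2_eq_square algebra_simps)
    have dp: "(p has_real_derivative - \<theta>') (at s)"
      unfolding p_def \<theta>'_def using s
      by (auto intro!: derivative_eq_intros simp: power2_eq_square field_simps)
    have d\<theta>: "(\<theta> has_real_derivative \<theta>') (at s)"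
      unfolding \<theta>_def \<theta>'_def using s by (auto intro!: derivative_eq_intros simp: power2_eq_square field_simps)
    have "N - 2 * s > 0" using n s by (simp add: N_def)
    then have g'0: "g' \<ge> 0" unfolding g'_def using s N by (intro divide_nonneg_nonneg add_nonneg_nonneg mult_nonneg_nonneg) auto
    \<comment> \<open>\<open>25/18\<close> is half of \<open>(5/3)^2\<close>, the largest value of
      \<open>(1 + 2 * s)^2\<close>.\<close>
    have \<theta>'0: "\<theta>' > 0" "\<theta>' \<le> 4" "25/18 * \<theta>' \<ge> 2"
    proof -
      have "(1 + 2 * s)\<^sup>2 \<le> (5/3)\<^sup>2" "(1 + 2 * s)\<^sup>2 \<ge> 1" using s by (auto intro!: power_mono)
      then show "\<theta>' > 0" "\<theta>' \<le> 4" "25/18 * \<theta>' \<ge> 2"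
        using s by (auto simp: \<theta>'_def divide_le_eq pos_le_divide_eq power2_eq_square)
    qed
    have K: "ln (1 - exp (- (g s * \<Lambda>))) - ln (g s) \<le> x / 2 + 1/4"
      using truncated_exp_ln_le(1)[OF gpos \<Lambda>(1)] ln\<Lambda> by simp
    obtain D where D: "(R has_real_derivative D) (at s)"
      and D_ge: "D \<ge> - \<theta>' * (x / 2 + 1/4) - p s * g' / g s"
      using has_derivative_truncated_exp[OF dg dp gpos _ g'0 _ \<Lambda>(1) K] s \<theta>'0 by (auto simp: p_def R_def)
    let ?L' = "1 / s + 5 * ln 2 - \<theta>' * ln (real n) + (real n * \<theta>' - 2) * x + D"
    have "(L has_real_derivative ?L') (at s)"
      unfolding L_def using s by (auto intro!: derivative_eq_intros d\<theta> D)
    moreover have "?L' \<ge> 0"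
    proof -
      have "p s * g' / g s = ((N - 2 * s) * (1 - 2 * s) + 2 * s * N) / ((1 + 2 * s) * s * N)"
      proof -
        have "w / v * (m / w\<^sup>2) / (s * N / w) = m / (v * s * N)" if "w \<noteq> 0" for v w m :: real
          using that s N by (simp add: power2_eq_square)
        from this[of "1 - 2 * s"] show ?thesis
          using s unfolding p_def g'_def g_def N_def[symmetric] by simp
      qed
      also have "\<dots> \<le> N / ((1 + 2 * s) * s * N)"
      proof (rule divide_right_mono)
        have "(N - 2 * s) * (1 - 2 * s) \<le> N * (1 - 2 * s)" using s by (intro mult_right_mono) auto
        then show "(N - 2 * s) * (1 - 2 * s) + 2 * s * N \<le> N" by (simp add: algebra_simps)
      qed (use s N in auto)
      also have "\<dots> = 1 / ((1 + 2 * s) * s)" using N by simp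
      \<comment> \<open>Partial fractions isolate the singular part, which cancels against the
        derivative of \<open>ln s\<close>, and leave a gain of at least \<open>6/5\<close>.\<close>
      also have "\<dots> = 1 / s - 2 / (1 + 2 * s)" using s by (simp add: field_simps)
      also have "\<dots> \<le> 1 / s - 6/5"
      proof -
        have "2 / (1 + 2 * s) \<ge> 6/5" using s by (simp add: pos_le_divide_eq)
        then show ?thesis by linarith
      qed
      finally have 1: "p s * g' / g s \<le> 1 / s - 6/5" .
      have "\<theta>' * ln (real n) \<le> \<theta>' * (ln 2 + (real n - 2) * ln 2)"
        using ln_real_nat_le[OF n] \<theta>'0 by (intro mult_left_mono) auto
      moreover have "\<theta>' * ((real n - 2) * ln 2) \<le> \<theta>' * ((real n - 2) * x)"
        using x n \<theta>'0 by (intro mult_left_mono) auto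
      moreover have "(real n * \<theta>' - 2) * x \<ge> (real n * \<theta>' - 25/18 * \<theta>') * x"
        using \<theta>'0 x ln2_ge_two_thirds by (intro mult_right_mono) auto
      moreover have "\<theta>' * x \<ge> 0" using \<theta>'0 x ln2_ge_two_thirds by simp
      \<comment> \<open>Collecting the multiples of \<open>\<theta>' * x\<close> leaves the
        coefficient \<open>2 - 25/18 - 1/2 = 1/9\<close>.\<close>
      ultimately have 2: "(real n * \<theta>' - 2) * x - \<theta>' * ln (real n) - \<theta>' * (x / 2 + 1/4) \<ge> - \<theta>' * (ln 2 + 1/4)"
        by (simp add: algebra_simps)
      \<comment> \<open>The total is then at least
        \<open>6/5 + 5 * ln 2 - 4 * (ln 2 + 1/4) = 1/5 + ln 2\<close>.\<close>
      have "\<theta>' * (ln 2 + 1/4) \<le> 4 * (ln 2 + 1/4)" using \<theta>'0 ln2_ge_two_thirds by (intro mult_right_mono) auto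
      with 1 2 D_ge ln2_ge_two_thirds ln2_le_25_over_36 show ?thesis by (simp add: algebra_simps)
    qed
    ultimately show "\<exists>y. (L has_real_derivative y) (at s) \<and> 0 \<le> y" by blast
  qed
  then show ?thesis using L s by simp
qed

text \<open>The branch \<open>s1 = (1 - s) / 2\<close>. Here \<open>g \<ge> 1\<close>, so the
  truncated integral is at most 1 and the decrease of its exponent \<open>p\<close> costs
  nothing.\<close>

lemma wos_log_mono_high:
  assumes n: "2 \<le> n" and s: "1/3 \<le> a" "a \<le> b" "b < 1"
    and x: "ln 2 \<le> x" and \<Lambda>: "0 < \<Lambda>"
  shows "wos_log ((1 - a) / 2) n a x \<Lambda> \<le> wos_log ((1 - b) / 2) n b x \<Lambda>"
proof -
  define g where "g = (\<lambda>s::real. 2 * real n * (1 + s) / (1 - s) - (3 + s) / 2)"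
  define p where "p = (\<lambda>s::real. (1 - s) / (3 + s))"
  define \<theta> where "\<theta> = (\<lambda>s::real. 2 * (1 + s) / (3 + s))"
  define R where "R = (\<lambda>s. p s * (ln (1 - exp (- (g s * \<Lambda>))) - ln (g s)))"
  define L where "L = (\<lambda>s. ln s + 5 * s * ln 2 - \<theta> s * ln (real n) +
     (real n * \<theta> s - (1 + s) / 2) * x + R s)"
  have L: "wos_log ((1 - s) / 2) n s x \<Lambda> = L s" if "1/3 \<le> s" "s < 1" for s
  proof -
    have gap: "wos_gap ((1 - s) / 2) n s = g s" using that by (simp add: wos_gap_def g_def field_simps)
    have q: "1 + (1 - s) / 2 + s = (3 + s) / 2" "(1 - s) / 2 + s = (1 + s) / 2" "1 - (1 - s) / 2 - s = (1 - s) / 2"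
      by (auto simp: field_simps)
    have q': "2 * (u / 2) / (v / 2) = 2 * u / v" "u / 2 / (v / 2) = u / v" for u v :: real
      by auto
    show ?thesis unfolding wos_log_def Let_def gap q q' L_def R_def p_def \<theta>_def ..
  qed
  have "L a \<le> L b"
  proof (rule DERIV_nonneg_imp_nondecreasing[OF s(2)])
    fix s assume "a \<le> s" "s \<le> b"
    then have s: "1/3 \<le> s" "s < 1" using assms by auto
    define g' where "g' = 4 * real n / (1 - s)\<^sup>2 - 1/2"
    define \<theta>' where "\<theta>' = 4 / (3 + s)\<^sup>2"
    \<comment> \<open>\<open>g s\<close> is \<open>2 * Z - (3 + s) / 2\<close>, and one copy of
      \<open>Z\<close> absorbs the subtracted term because \<open>n \<ge> 2\<close>.\<close>
    have g_ge: "g s \<ge> real n * (1 + s) / (1 - s)"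
    proof -
      define Z where "Z = real n * (1 + s) / (1 - s)"
      have "(3 + s) / 2 * (1 - s) \<le> 2 * (1 + s)" using s by (simp add: algebra_simps)
      also have "\<dots> \<le> real n * (1 + s)" using n s by (intro mult_right_mono) auto
      finally have "(3 + s) / 2 \<le> Z" using s by (simp add: pos_le_divide_eq Z_def)
      moreover have "g s = 2 * Z - (3 + s) / 2" by (simp add: g_def Z_def)
      ultimately show ?thesis unfolding Z_def[symmetric] by linarith
    qed
    moreover have "1 \<le> real n * (1 + s) / (1 - s)"
    proof -
      have "1 - s \<le> 1 * (1 + s)" using s by simp
      also have "\<dots> \<le> real n * (1 + s)" using n s by (intro mult_right_mono) auto
      finally show ?thesis using s by (simp add: pos_le_divide_eq)
    qed
    ultimately have g1: "g s \<ge> 1" by linarith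
    then have gpos: "g s > 0" by simp
    have dg: "(g has_real_derivative g') (at s)"
    proof -
      have "(g has_real_derivative
          (2 * real n * (1 - s) - 2 * real n * (1 + s) * (- 1)) / ((1 - s) * (1 - s)) - 1/2) (at s)"
        unfolding g_def using s by (auto intro!: derivative_eq_intros)
      moreover have "2 * real n * (1 - s) - 2 * real n * (1 + s) * (- 1) = 4 * real n"
        by (simp add: algebra_simps)
      ultimately show ?thesis by (simp add: g'_def power2_eq_square)
    qed
    have dp: "(p has_real_derivative - \<theta>') (at s)"
      unfolding p_def \<theta>'_def using s
      by (auto intro!: derivative_eq_intros simp: power2_eq_square field_simps)
    have d\<theta>: "(\<theta> has_real_derivative \<theta>') (at s)"
      unfolding \<theta>_def \<theta>'_def using s by (auto intro!: derivative_eq_intros simp: power2_eq_square field_simps)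
    have sq1: "(1 - s)\<^sup>2 \<le> 1" "(1 - s)\<^sup>2 > 0" using s by (auto intro!: power_le_one)
    have g'0: "g' \<ge> 0"
    proof -
      have "1/2 * (1 - s)\<^sup>2 \<le> 4 * real n" using sq1 n by linarith
      then show ?thesis using sq1 by (simp add: g'_def pos_le_divide_eq)
    qed
    have \<theta>': "\<theta>' > 0" "\<theta>' \<le> 4/9" "2 * \<theta>' \<ge> 1/2"
    proof -
      have "(3 + s)\<^sup>2 \<le> 4\<^sup>2" "(3 + s)\<^sup>2 \<ge> 3\<^sup>2"
        using s power_mono[of "3 + s" 4 2] power_mono[of 3 "3 + s" 2] by auto
      then show "\<theta>' > 0" "\<theta>' \<le> 4/9" "2 * \<theta>' \<ge> 1/2"
        using s by (auto simp: \<theta>'_def divide_le_eq pos_le_divide_eq)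
    qed
    have K: "ln (1 - exp (- (g s * \<Lambda>))) - ln (g s) \<le> 0"
      using truncated_exp_ln_le(2)[OF gpos \<Lambda>(1)] ln_ge_zero[OF g1] by linarith
    obtain D where D: "(R has_real_derivative D) (at s)"
      and D_ge: "D \<ge> - \<theta>' * 0 - p s * g' / g s"
      using has_derivative_truncated_exp[OF dg dp gpos _ g'0 _ \<Lambda>(1) K] s \<theta>' by (auto simp: p_def R_def)
    let ?L' = "1 / s + 5 * ln 2 - \<theta>' * ln (real n) + (real n * \<theta>' - 1/2) * x + D"
    have "(L has_real_derivative ?L') (at s)"
      unfolding L_def using s by (auto intro!: derivative_eq_intros d\<theta> D)
    moreover have "?L' \<ge> 0"
    proof -
      have "p s * g' / g s \<le> p s * (4 * real n / (1 - s)\<^sup>2) / (real n * (1 + s) / (1 - s))"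
        using s n g'0 g_ge by (intro frac_le mult_left_mono) (auto simp: p_def g'_def)
      also have "\<dots> = 4 / ((3 + s) * (1 + s))"
      proof -
        have "w / v * (4 * k / w\<^sup>2) / (k * u / w) = 4 / (v * u)" if "w \<noteq> 0" "k \<noteq> 0" for v w u k :: real
          using that by (simp add: power2_eq_square)
        from this[of "1 - s" "real n"] show ?thesis using s n unfolding p_def by simp
      qed
      also have "\<dots> \<le> 4 / 3"
      proof -
        have "3 * 1 \<le> (3 + s) * (1 + s)" using s by (intro mult_mono) auto
        then show ?thesis using s by (intro divide_left_mono) auto
      qed
      finally have 1: "p s * g' / g s \<le> 4 / 3" .
      have "\<theta>' * ln (real n) \<le> \<theta>' * (ln 2 + (real n - 2) * ln 2)"
        using ln_real_nat_le[OF n] \<theta>' by (intro mult_left_mono) auto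
      moreover have "\<theta>' * ((real n - 2) * ln 2) \<le> \<theta>' * ((real n - 2) * x)"
        using x n \<theta>' by (intro mult_left_mono) auto
      \<comment> \<open>By \<open>2 * \<theta>' \<ge> 1/2\<close> the coefficient of
        \<open>x\<close> is at least \<open>(n - 2) * \<theta>'\<close>, which cancels the
        \<open>n\<close>-dependent part of the bound on \<open>ln n\<close>.\<close>
      moreover have "(real n * \<theta>' - 1/2) * x \<ge> (real n * \<theta>' - 2 * \<theta>') * x"
        using \<theta>' x ln2_ge_two_thirds by (intro mult_right_mono) auto
      ultimately have 2: "(real n * \<theta>' - 1/2) * x - \<theta>' * ln (real n) \<ge> - \<theta>' * ln 2"
        by (simp add: algebra_simps)
      \<comment> \<open>What remains is at least \<open>1 + 5 * ln 2 - 4/9 * ln 2 - 4/3\<close>,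
        which is positive.\<close>
      have "\<theta>' * ln 2 \<le> 4/9 * ln 2" using \<theta>' by (intro mult_right_mono) auto
      moreover have "1 / s \<ge> 1" using s by simp
      ultimately show ?thesis using 1 2 D_ge ln2_ge_two_thirds ln2_le_25_over_36 by linarith
    qed
    ultimately show "\<exists>y. (L has_real_derivative y) (at s) \<and> 0 \<le> y" by blast
  qed
  then show ?thesis using L s by simp
qed

section \<open>Explicit form of the bound and assembly of the estimates\<close>

lemma s1_of_bounds:
  assumes "0 < s" "s < 1"
  shows "0 < s1_of s" "s1_of s + s < 1"
  using assms by (auto simp: s1_of_def field_simps)

text \<open>The factor \<open>s * 2 powr (4 * s)\<close> of the prefactor is distributed over both
  summands: it turns \<open>2 powr s / s1\<close> into \<open>2 powr (5 * s) * (s / s1)\<close>,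
  bounded near 0, and cancels \<open>2 powr - (4 * s) / s\<close> in the second.\<close>

lemma wos_bound_eq:
  fixes r t s :: real
  assumes n: "2 \<le> n" and s: "0 < s" "s < 1" and t: "0 \<le> t" "t < r"
  defines "s1 \<equiv> s1_of s"
  shows "wos_bound n s r t = 2 * wos_K n s * (2 powr (5 * s) * (s / s1) +
    (real n * Beta (1 - (1 + s1 + s) / 2) (real n)) powr (2 * (s1 + s) / (1 + s1 + s)) *
      exp (wos_log s1 n s (ln (2 * r / (r - t))) (ln (2 * (r + t) / (r - t)))))"
proof -
  have s1: "0 < s1" "s1 + s < 1" using s1_of_bounds[OF s] by (auto simp: s1_def)
  have gam: "gamma_of n s = - wos_gap s1 n s"
  proof -
    have "(1 + s1 + s) * (s1 - real n) = - ((1 + s1 + s) * (real n - s1))" by (simp add: algebra_simps)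
    then show ?thesis unfolding gamma_of_def wos_gap_def s1_def[symmetric] by simp
  qed
  show ?thesis
    unfolding wos_bound_def Let_def gam s1_def[symmetric] wos_prefactor_eq[OF n s]
      wos_second_term_eq[OF n s1(1) s(1) s1(2) t]
    using s by (simp add: powr_minus powr_add[symmetric] field_simps)
qed

text \<open>By reflection \<open>s * (1 - s) * pi / sin (pi * s)\<close> equals
  \<open>Gamma (1 + s) * Gamma (2 - s)\<close>, which is at most 1; the other factor compares
  \<open>Gamma (1/2) = sqrt pi\<close> with \<open>Gamma (s + 1/2)\<close>.\<close>

lemma inverse_halfspace_exit_le:
  assumes s: "0 < s" "s < 1" and n: "0 < n"
  shows "1 / halfspace_exit n s \<le> 2 * ((1 + 2 * s) / (1 - s)) * (Gamma (real n / 2 + s) / Gamma (real n / 2))"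
proof -
  define A where "A = Gamma (real n / 2 + s) / Gamma (real n / 2)"
  have A: "A > 0" unfolding A_def using s n by (intro divide_pos_pos Gamma_real_pos add_pos_pos) auto
  have sin: "sin (pi * s) > 0" using s by (intro sin_gt_zero) auto
  have G1: "Gamma (1 + s) = s * Gamma s"
    using s by (subst add.commute, intro Gamma_plus1) (auto elim!: nonpos_Ints_cases)
  have G2: "Gamma (1 + (1 - s)) = (1 - s) * Gamma (1 - s)"
    using s by (subst add.commute, intro Gamma_plus1) (auto elim!: nonpos_Ints_cases)
  have G3: "Gamma (1 + (s + 1/2)) = (s + 1/2) * Gamma (s + 1/2)"
    using s by (subst add.commute, intro Gamma_plus1) (auto elim!: nonpos_Ints_cases)
  have G4: "Gamma (1 + 1/2) = (1/2) * Gamma (1/2 :: real)"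
    by (subst add.commute, intro Gamma_plus1) (auto elim!: nonpos_Ints_cases)
  have "s * (pi / sin (pi * s)) * (1 - s) = Gamma (1 + s) * Gamma (1 + (1 - s))"
    unfolding G1 G2 Gamma_reflection_real[OF s, symmetric] by simp
  also have "\<dots> \<le> 1 * 1" using s by (intro mult_mono Gamma_le_one) auto
  finally have 1: "s * (pi / sin (pi * s)) \<le> 1 / (1 - s)" using s by (simp add: pos_le_divide_eq)
  \<comment> \<open>Both arguments are raised by 1 to reach the range from \<open>3/2\<close> on,
    where Gamma increases.\<close>
  have "Gamma (1 + 1/2) \<le> Gamma (1 + (s + 1/2))"
    using Gamma_real_strict_mono[of "1 + 1/2" "1 + (s + 1/2)"] s by simp
  then have "sqrt pi \<le> (1 + 2 * s) * Gamma (s + 1/2)"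
    unfolding G3 G4 by (simp add: Gamma_one_half_real algebra_simps)
  then have 2: "sqrt pi / Gamma (s + 1/2) \<le> 1 + 2 * s" using s by (simp add: divide_le_eq)
  have "1 / halfspace_exit n s = 2 * (s * (pi / sin (pi * s)) * (sqrt pi / Gamma (s + 1/2))) * A"
    by (simp add: halfspace_exit_def A_def field_simps)
  also have "\<dots> \<le> 2 * (1 / (1 - s) * (1 + 2 * s)) * A"
    using 1 2 A s sin by (intro mult_right_mono mult_left_mono mult_mono) auto
  finally show ?thesis by (simp add: A_def)
qed

text \<open>The nonnegative second summand is dropped, and the maximum in \<open>wos_K\<close> is
  bounded below by its first entry, which is at least \<open>2 powr (2 * s)\<close>. This reduces
  the claim to \<open>key\<close>.\<close>

lemma inverse_halfspace_exit_le_wos_bound: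
  assumes n: "2 \<le> n" and s: "0 < s" "s < 1" and t: "0 \<le> t" "t < r"
  shows "1 / halfspace_exit n s \<le> wos_bound n s r t"
proof -
  define A where "A = Gamma (real n / 2 + s) / Gamma (real n / 2)"
  have A: "A > 0" unfolding A_def using s n by (intro divide_pos_pos Gamma_real_pos add_pos_pos) auto
  have s1: "s1_of s > 0" using s1_of_bounds[OF s] by simp
  \<comment> \<open>\<open>14/3\<close> is \<open>7 * (2/3)\<close>, from
    \<open>ln 2 \<ge> 2/3\<close>.\<close>
  have e: "2 powr (7 * s) \<ge> 1 + 14/3 * s"
  proof -
    have "1 + 14/3 * s \<le> 1 + 7 * s * ln 2" using s ln2_ge_two_thirds by simp
    also have "\<dots> \<le> exp (7 * s * ln 2)" by (rule exp_ge_add_one_self)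
    finally show ?thesis by (simp add: powr_def)
  qed
  have key: "(1 + 2 * s) / (1 - s) \<le> 2 powr (7 * s) * (s / s1_of s)"
  proof -
    have "(1 + 2 * s) / (1 - s) \<le> (1 + 14/3 * s) * (s / s1_of s)"
    \<comment> \<open>In the first case \<open>s / s1 = 1\<close> and the quadratic inequality holds
      up to \<open>s = 5/14\<close>; in the second \<open>28/3 * s^2 \<ge> 28/27\<close>
      suffices.\<close>
    proof (cases "s \<le> 1/3")
      case True
      have "s * s \<le> 1/3 * s" using True s by (intro mult_right_mono) auto
      then have "1 + 2 * s \<le> (1 + 14/3 * s) * (1 - s)" using s by (simp add: algebra_simps)
      then show ?thesis using True s by (simp add: s1_of_def pos_divide_le_eq)
    next
      case False
      have "1/3 * (1/3) \<le> s * s" using False by (intro mult_mono) auto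
      then have "1 + 2 * s \<le> (1 + 14/3 * s) * (2 * s)" by (simp add: algebra_simps)
      then have "(1 + 2 * s) / (1 - s) \<le> (1 + 14/3 * s) * (2 * s) / (1 - s)"
        using s by (intro divide_right_mono) auto
      then show ?thesis using False s by (simp add: s1_of_def mult.commute)
    qed
    also have "\<dots> \<le> 2 powr (7 * s) * (s / s1_of s)"
      using e s s1 by (intro mult_right_mono) auto
    finally show ?thesis .
  qed
  have "1 / halfspace_exit n s \<le> 2 * ((1 + 2 * s) / (1 - s)) * A"
    using inverse_halfspace_exit_le[OF s, of n] n by (simp add: A_def)
  also have "\<dots> \<le> 2 * (2 powr (7 * s) * (s / s1_of s)) * A"
    using key A by (intro mult_right_mono mult_left_mono) auto
  also have "\<dots> = 2 * (A * 2 powr (2 * s)) * (2 powr (5 * s) * (s / s1_of s))"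
    using powr_add[of 2 "2 * s" "5 * s"] by simp
  also have "\<dots> \<le> 2 * wos_K n s * (2 powr (5 * s) * (s / s1_of s))"
  proof -
    have "Gamma (1 + s) \<le> 1" using s by (intro Gamma_le_one) auto
    then have "2 powr (2 * s) \<le> 2 powr (2 * s) / Gamma (1 + s)"
      using s by (simp add: pos_le_divide_eq)
    then have "A * 2 powr (2 * s) \<le> wos_K n s"
      unfolding wos_K_def A_def[symmetric] using A by (intro mult_left_mono) auto
    then show ?thesis using s s1 by (intro mult_right_mono mult_left_mono) auto
  qed
  also have "\<dots> \<le> wos_bound n s r t"
    unfolding wos_bound_eq[OF n s t] using wos_K_pos[OF n s]
    by (intro mult_left_mono) (auto intro!: mult_nonneg_nonneg)
  finally show ?thesis .
qed

text \<open>The last inequality is \<open>(r + t) * (r - t) \<le> r * r\<close> in logarithmic form.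
  The three together are the hypotheses of \<open>wos_log_mono\<close> on \<open>x\<close> and
  \<open>\<Lambda>\<close>.\<close>

lemma ln_ratio_bounds:
  fixes r t :: real
  assumes t: "0 \<le> t" "t < r"
  shows "ln 2 \<le> ln (2 * r / (r - t))" "0 < ln (2 * (r + t) / (r - t))"
    "ln (2 * (r + t) / (r - t)) \<le> 2 * ln (2 * r / (r - t)) - ln 2"
proof -
  have pos: "r - t > 0" "r > 0" using t by auto
  show "ln 2 \<le> ln (2 * r / (r - t))" using t by (intro ln_mono) (auto simp: pos_le_divide_eq)
  show "0 < ln (2 * (r + t) / (r - t))" using t by (intro ln_gt_zero) (auto simp: pos_less_divide_eq)
  have "(r + t) * (r - t) \<le> r * r" using zero_le_square[of t] by (simp add: algebra_simps)
  then have "2 * ((r + t) * (r - t)) / (r - t)\<^sup>2 \<le> 2 * (r * r) / (r - t)\<^sup>2"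
    by (intro divide_right_mono mult_left_mono) auto
  then have "2 * (r + t) / (r - t) \<le> (2 * r / (r - t)) ^ 2 / 2"
    using pos by (simp add: power2_eq_square)
  then have "ln (2 * (r + t) / (r - t)) \<le> ln ((2 * r / (r - t)) ^ 2 / 2)"
    using t by (intro ln_mono) auto
  also have "\<dots> = 2 * ln (2 * r / (r - t)) - ln 2"
    using pos by (simp add: ln_div ln_realpow)
  finally show "ln (2 * (r + t) / (r - t)) \<le> 2 * ln (2 * r / (r - t)) - ln 2" .
qed

text \<open>Both branches of \<open>s1_of\<close> equal \<open>1/3\<close> at
  \<open>s = 1/3\<close>, so the two monotonicity results chain through that point.\<close>

lemma wos_log_mono:
  assumes n: "2 \<le> n" and s: "0 < a" "a \<le> b" "b < 1"
    and x: "ln 2 \<le> x" and \<Lambda>: "0 < \<Lambda>" "\<Lambda> \<le> 2 * x - ln 2"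
  shows "wos_log (s1_of a) n a x \<Lambda> \<le> wos_log (s1_of b) n b x \<Lambda>"
proof -
  have low: "wos_log (s1_of a) n a x \<Lambda> \<le> wos_log (s1_of b) n b x \<Lambda>"
    if "0 < a" "a \<le> b" "b \<le> 1/3" for a b
    using wos_log_mono_low[OF n that x \<Lambda>] that by (simp add: s1_of_def)
  have high: "wos_log (s1_of a) n a x \<Lambda> \<le> wos_log (s1_of b) n b x \<Lambda>"
    if "1/3 \<le> a" "a \<le> b" "b < 1" for a b
  proof -
    have "s1_of u = (1 - u) / 2" if "1/3 \<le> u" for u using that by (auto simp: s1_of_def)
    from this[of a] this[of b] have eq: "s1_of a = (1 - a) / 2" "s1_of b = (1 - b) / 2"
      using that by linarith+
    show ?thesis unfolding eq by (rule wos_log_mono_high[OF n that x \<Lambda>(1)])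
  qed
  consider "b \<le> 1/3" | "1/3 \<le> a" | "a \<le> 1/3" "1/3 \<le> b" by linarith
  then show ?thesis
  proof cases
    case 3
    then show ?thesis using low[of a "1/3"] high[of "1/3" b] s by linarith
  qed (use low high s in auto)
qed

text \<open>All factors in \<open>wos_bound_eq\<close> are nonnegative and increase with
  \<open>s\<close>. For the power of \<open>n * Beta\<close>, the exponent increases and so does the
  base, which is at least 1.\<close>

lemma wos_bound_mono_s:
  assumes n: "2 \<le> n" and s: "0 < a" "a \<le> b" "b < 1" and t: "0 \<le> t" "t < r"
  shows "wos_bound n a r t \<le> wos_bound n b r t"
proof -
  have a: "0 < a" "a < 1" and b: "0 < b" "b < 1" using s by auto
  note sa = s1_of_bounds[OF a] and sb = s1_of_bounds[OF b]
  define qa where "qa = 1 + s1_of a + a"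
  define qb where "qb = 1 + s1_of b + b"
  have q: "1 < qa" "qa \<le> qb" "qb < 2"
    using sa sb s by (auto simp: qa_def qb_def s1_of_def field_simps)
  define Ba where "Ba = real n * Beta (1 - qa / 2) (real n)"
  define Bb where "Bb = real n * Beta (1 - qb / 2) (real n)"
  have B: "1 \<le> Ba" "Ba \<le> Bb"
  proof -
    have "Beta 1 (real n) \<le> Beta (1 - qa / 2) (real n)" using q n by (intro Beta_mono_left) auto
    then show "1 \<le> Ba" using n by (simp add: Ba_def Beta_one_left divide_le_eq mult.commute)
    have "Beta (1 - qa / 2) (real n) \<le> Beta (1 - qb / 2) (real n)" using q n by (intro Beta_mono_left) auto
    then show "Ba \<le> Bb" using n by (simp add: Ba_def Bb_def)
  qed
  \<comment> \<open>Written as \<open>2 - 2 / q\<close>, the exponent visibly increases with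
    \<open>q\<close>.\<close>
  have th: "2 * (s1_of a + a) / qa \<le> 2 * (s1_of b + b) / qb"
  proof -
    have "2 * (s1_of a + a) / qa = 2 - 2 / qa" "2 * (s1_of b + b) / qb = 2 - 2 / qb"
      using q by (auto simp: qa_def qb_def field_simps)
    moreover have "2 / qb \<le> 2 / qa" using q by (intro divide_left_mono) auto
    ultimately show ?thesis by simp
  qed
  have "Ba powr (2 * (s1_of a + a) / qa) \<le> Bb powr (2 * (s1_of a + a) / qa)"
    using B q sa a by (intro powr_mono2) auto
  also have "\<dots> \<le> Bb powr (2 * (s1_of b + b) / qb)"
    using B th by (intro powr_mono) auto
  finally have B_le: "Ba powr (2 * (s1_of a + a) / qa) \<le> Bb powr (2 * (s1_of b + b) / qb)" .
  have "a / s1_of a \<le> b / s1_of b"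
  proof -
    \<comment> \<open>\<open>s1_of\<close> rises up to \<open>1/3\<close> and falls afterwards. For
      \<open>a \<le> 1/3\<close> the quotient at \<open>a\<close> is 1, its least value; for larger
      \<open>a\<close> the denominator decreases.\<close>
    have "s1_of b \<le> s1_of a \<or> a / s1_of a = 1 \<and> b / s1_of b \<ge> 1"
      using a b s by (auto simp: s1_of_def)
    then show ?thesis
    proof (elim disjE conjE)
      assume "s1_of b \<le> s1_of a"
      then show ?thesis using sb a s by (intro frac_le) auto
    qed linarith
  qed
  moreover have "2 powr (5 * a) \<le> (2::real) powr (5 * b)" using s by simp
  ultimately have T1: "2 powr (5 * a) * (a / s1_of a) \<le> 2 powr (5 * b) * (b / s1_of b)"
    using a sa by (intro mult_mono) auto
  have T2: "Ba powr (2 * (s1_of a + a) / qa) * exp (wos_log (s1_of a) n a (ln (2 * r / (r - t))) (ln (2 * (r + t) / (r - t))))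
     \<le> Bb powr (2 * (s1_of b + b) / qb) * exp (wos_log (s1_of b) n b (ln (2 * r / (r - t))) (ln (2 * (r + t) / (r - t))))"
    using B_le wos_log_mono[OF n s ln_ratio_bounds[OF t]] by (intro mult_mono) auto
  show ?thesis
    unfolding wos_bound_eq[OF n a t] wos_bound_eq[OF n b t] qa_def[symmetric] qb_def[symmetric]
      Ba_def[symmetric] Bb_def[symmetric]
    using wos_K_mono[OF n s] wos_K_pos[OF n a] a sa
    by (intro mult_mono[OF _ add_mono[OF T1 T2]]) (auto intro!: add_nonneg_nonneg mult_nonneg_nonneg)
qed

text \<open>Only the two logarithmic ratios depend on \<open>t\<close>, and both increase. They
  enter \<open>wos_log\<close> with nonnegative weights: \<open>n * \<theta> \<ge> s1 + s\<close>
  because \<open>q \<le> 2 * n\<close>, and \<open>1 - s1 - s > 0\<close>.\<close>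

lemma wos_bound_mono_t:
  assumes n: "2 \<le> n" and s: "0 < s" "s < 1" and t: "0 \<le> t" "t \<le> u" "u < r"
  shows "wos_bound n s r t \<le> wos_bound n s r u"
proof -
  have t': "0 \<le> t" "t < r" and u: "0 \<le> u" "u < r" using t by auto
  have s1: "0 < s1_of s" "s1_of s + s < 1" using s1_of_bounds[OF s] by auto
  define q where "q = 1 + s1_of s + s"
  define g where "g = wos_gap (s1_of s) n s"
  have q: "1 < q" "q < 2" using s s1 by (auto simp: q_def)
  have g: "g > 0" unfolding g_def using n s s1 by (intro wos_gap_pos) auto
  have coef: "0 \<le> real n * (2 * (s1_of s + s) / q) - (s1_of s + s)"
  proof -
    have "(s1_of s + s) * q \<le> (s1_of s + s) * (2 * real n)"
      using q n s s1 by (intro mult_left_mono) auto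
    then show ?thesis using q by (simp add: pos_le_divide_eq mult.commute mult.left_commute)
  qed
  have x: "ln (2 * r / (r - t)) \<le> ln (2 * r / (r - u))"
    using t by (intro ln_mono divide_left_mono) auto
  have \<Lambda>: "ln (2 * (r + t) / (r - t)) \<le> ln (2 * (r + u) / (r - u))"
    using t by (intro ln_mono frac_le) auto
  have "g * ln (2 * (r + t) / (r - t)) > 0" using g ln_ratio_bounds(2)[OF t'] by simp
  then have "ln (1 - exp (- (g * ln (2 * (r + t) / (r - t))))) \<le> ln (1 - exp (- (g * ln (2 * (r + u) / (r - u)))))"
    using g \<Lambda> by (intro ln_mono) auto
  then have "wos_log (s1_of s) n s (ln (2 * r / (r - t))) (ln (2 * (r + t) / (r - t)))
      \<le> wos_log (s1_of s) n s (ln (2 * r / (r - u))) (ln (2 * (r + u) / (r - u)))"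
    unfolding wos_log_def Let_def q_def[symmetric] g_def[symmetric]
    using coef x q s s1 by (intro add_mono mult_left_mono diff_mono) (auto intro!: divide_nonneg_nonneg)
  then show ?thesis
    unfolding wos_bound_eq[OF n s t'] wos_bound_eq[OF n s u]
    using wos_K_pos[OF n s] by (intro mult_left_mono add_left_mono) auto
qed

theorem theorem4p1:
  fixes x0 :: "real^'n" and s r :: real
  assumes "CARD('n) \<ge> 2" and "0 < s" and "s < 1" and "0 < r" and "x0 \<in> ball 0 r"
  shows "wos_expected_steps s r x0 \<le> ennreal (wos_bound CARD('n) s r (norm x0))
       \<and> mono_on {0<..<1} (\<lambda>\<sigma>. wos_bound CARD('n) \<sigma> r (norm x0))
       \<and> mono_on {0..<r} (\<lambda>t. wos_bound CARD('n) s r t)"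
proof (intro conjI)
  have x0: "0 \<le> norm x0" "norm x0 < r" using assms by auto
  have "wos_expected_steps s r x0 \<le> ennreal (1 / halfspace_exit CARD('n) s)"
    using assms by (intro wos_expected_steps_le)
  also have "\<dots> \<le> ennreal (wos_bound CARD('n) s r (norm x0))"
    using assms x0 by (intro ennreal_leI inverse_halfspace_exit_le_wos_bound)
  finally show "wos_expected_steps s r x0 \<le> ennreal (wos_bound CARD('n) s r (norm x0))" .
  show "mono_on {0<..<1} (\<lambda>\<sigma>. wos_bound CARD('n) \<sigma> r (norm x0))"
    using assms x0 by (intro mono_onI wos_bound_mono_s) auto
  show "mono_on {0..<r} (\<lambda>t. wos_bound CARD('n) s r t)"
    using assms by (intro mono_onI wos_bound_mono_t) auto
qed

end
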